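(* Let $W=(w_{ij})\in\mathbb{R}^{N\times N}$ be a symmetric matrix with nonnegative entries, let $\Gamma_1,\dots,\Gamma_k$ be a partition of $\{1,\dots,N\}$ into nonempty sets, and let $L$, $L_{\mathrm{iso}}$, $D_\delta$, $X_{\mathrm{rcut}}$ be the associated matrices defined in the context. If $$\|D_\delta\| < \frac{\lambda_{k+1}(L_{\mathrm{iso}})}{4},$$ then $X_{\mathrm{rcut}}$ is the unique global minimizer of the semidefinite program $$\min_{Z\in\mathbb{R}^{N\times N},\ Z=Z^\top}\ \langle L,Z\rangle\quad\text{subject to}\quad Z\succeq 0,\quad Z\ge 0,\quad \operatorname{Tr}(Z)=k,\quad Z1_N=1_N .$$ Moreover, $\lambda_{k+1}(L_{\mathrm{iso}})=\min_{1\le a\le k}\lambda_2\big(L_{\mathrm{iso}}^{(a,a)}\big)$.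
   Context: Notation: $\lambda_l(M)$ is the $l$-th smallest eigenvalue of $M$, counted with multiplicity; $\|M\|$ is the operator norm; $\langle M,Z\rangle=\operatorname{Tr}(M^\top Z)$; $Z\succeq0$ means positive semidefinite; $Z\ge0$ means entrywise nonnegative; $1_N$ is the all-ones vector. Given $W$ and the partition, let $n_a=|\Gamma_a|$; for a matrix $M\in\mathbb{R}^{N\times N}$, $M^{(a,b)}$ is the block with rows in $\Gamma_a$ and columns in $\Gamma_b$. Let $D=\operatorname{diag}(W1_N)$ and $L=D-W$ (graph Laplacian). Let $W_{\mathrm{iso}}$ be the matrix with $W_{\mathrm{iso}}^{(a,a)}=W^{(a,a)}$ and $W_{\mathrm{iso}}^{(a,b)}=0$ for $a\ne b$; $D_{\mathrm{iso}}=\operatorname{diag}(W_{\mathrm{iso}}1_N)$; $L_{\mathrm{iso}}=D_{\mathrm{iso}}-W_{\mathrm{iso}}$. Then $L_{\mathrm{iso}}^{(a,a)}$ is the graph Laplacian of the subgraph on $\Gamma_a$. Let $D_\delta=D-D_{\mathrm{iso}}$, so that $\|D_\delta\|=\max_{a}\max_{i\in\Gamma_a}\sum_{j\notin\Gamma_a}w_{ij}$. Finally $$X_{\mathrm{rcut}}=\sum_{a=1}^k\frac1{|\Gamma_a|}1_{\Gamma_a}1_{\Gamma_a}^\top,$$ where $1_{\Gamma_a}\in\mathbb{R}^N$ is the indicator vector of $\Gamma_a$. Conventions: $N>k$, so that $\lambda_{k+1}(L_{\mathrm{iso}})$ exists; $\lambda_2$ of a $1\times1$ matrix is taken to be $+\infty$.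 *)

theory Defs
  imports
    Complex_Main
    "HOL-Library.Extended_Real"
    "HOL-Library.Disjoint_Sets"
    "Jordan_Normal_Form.Char_Poly"
    "Jordan_Normal_Form.DL_Submatrix"
begin

text \<open>Vertices are numbered \<open>0, \<dots>, N - 1\<close>, the clusters \<open>\<Gamma> 1, \<dots>, \<Gamma> k\<close>.\<close>

definition ones_vec :: "nat \<Rightarrow> real vec" where
  "ones_vec n = vec n (\<lambda>_. 1)"

definition ind_vec :: "nat \<Rightarrow> nat set \<Rightarrow> real vec" where
  "ind_vec n S = vec n (\<lambda>i. if i \<in> S then 1 else 0)"

definition outer_prod :: "real vec \<Rightarrow> real vec \<Rightarrow> real mat" where
  "outer_prod u v = mat (dim_vec u) (dim_vec v) (\<lambda>(i, j). u $ i * v $ j)"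

definition trace_mat :: "real mat \<Rightarrow> real" where
  "trace_mat A = (\<Sum>i<dim_row A. A $$ (i, i))"

definition mat_inner :: "real mat \<Rightarrow> real mat \<Rightarrow> real" where
  "mat_inner A B = trace_mat (transpose_mat A * B)"

definition l2_norm :: "real vec \<Rightarrow> real" where
  "l2_norm v = sqrt (v \<bullet> v)"

definition op_norm :: "real mat \<Rightarrow> real" where
  "op_norm A = (SUP v\<in>{v \<in> carrier_vec (dim_col A). l2_norm v \<le> 1}. l2_norm (A *\<^sub>v v))"

definition psd :: "real mat \<Rightarrow> bool" where
  "psd A \<longleftrightarrow> square_mat A \<and> transpose_mat A = A \<and>
     (\<forall>v \<in> carrier_vec (dim_row A). 0 \<le> v \<bullet> (A *\<^sub>v v))"

text \<open>
  Eigenvalues are the real roots of the characteristic polynomial, repeated according to their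
  multiplicity as roots. This is only used for symmetric \<open>A\<close>, where the list has length
  \<open>dim_row A\<close> and algebraic and geometric multiplicities agree. The index \<open>l\<close> starts
  at 1, and \<open>eigval l A\<close> is meaningful for \<open>1 \<le> l \<le> dim_row A\<close>.
\<close>
definition eigval :: "nat \<Rightarrow> real mat \<Rightarrow> real" where
  "eigval l A = sorted_list_of_multiset (proots (char_poly A)) ! (l - 1)"

text \<open>The second smallest eigenvalue, with the convention that it is \<open>\<infinity>\<close> for a \<open>1 \<times> 1\<close> matrix.\<close>
definition eigval2 :: "real mat \<Rightarrow> ereal" where
  "eigval2 A = (if dim_row A = 1 then \<infinity> else ereal (eigval 2 A))"

definition deg_mat :: "real mat \<Rightarrow> real mat" where
  "deg_mat W = mat_diag (dim_row W) (\<lambda>i. (W *\<^sub>v ones_vec (dim_col W)) $ i)"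

definition laplacian :: "real mat \<Rightarrow> real mat" where
  "laplacian W = deg_mat W - W"

definition iso_mat :: "nat \<Rightarrow> (nat \<Rightarrow> nat set) \<Rightarrow> real mat \<Rightarrow> real mat" where
  "iso_mat k \<Gamma> W = mat (dim_row W) (dim_col W)
     (\<lambda>(i, j). if \<exists>a\<in>{1..k}. i \<in> \<Gamma> a \<and> j \<in> \<Gamma> a then W $$ (i, j) else 0)"

definition D_delta :: "nat \<Rightarrow> (nat \<Rightarrow> nat set) \<Rightarrow> real mat \<Rightarrow> real mat" where
  "D_delta k \<Gamma> W = deg_mat W - deg_mat (iso_mat k \<Gamma> W)"

definition L_iso :: "nat \<Rightarrow> (nat \<Rightarrow> nat set) \<Rightarrow> real mat \<Rightarrow> real mat" where
  "L_iso k \<Gamma> W = laplacian (iso_mat k \<Gamma> W)"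

text \<open>The sum is taken entrywise because \<open>real mat\<close>, without fixed dimensions, is not an additive monoid.\<close>
definition X_rcut :: "nat \<Rightarrow> nat \<Rightarrow> (nat \<Rightarrow> nat set) \<Rightarrow> real mat" where
  "X_rcut N k \<Gamma> = mat N N (\<lambda>(i, j). \<Sum>a=1..k.
     ((1 / real (card (\<Gamma> a))) \<cdot>\<^sub>m outer_prod (ind_vec N (\<Gamma> a)) (ind_vec N (\<Gamma> a))) $$ (i, j))"

definition sdp_feasible :: "nat \<Rightarrow> nat \<Rightarrow> real mat \<Rightarrow> bool" where
  "sdp_feasible N k Z \<longleftrightarrow>
     Z \<in> carrier_mat N N \<and> transpose_mat Z = Z \<and> psd Z \<and>
     (\<forall>i<N. \<forall>j<N. 0 \<le> Z $$ (i, j)) \<and>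
     trace_mat Z = real k \<and> Z *\<^sub>v ones_vec N = ones_vec N"

end

theory Submission
  imports Defs
begin

text \<open>
  Let \<open>P = X_rcut\<close>, the orthogonal projection onto the span of the cluster indicators, and for a
  feasible \<open>Z\<close> put \<open>\<epsilon> = \<langle>I - P, Z\<rangle> \<ge> 0\<close>, which is also a weighted sum of the entries of \<open>Z\<close>
  outside the diagonal blocks. Since \<open>L_iso \<succeq> \<lambda> (I - P)\<close> with \<open>\<lambda> = \<lambda>\<^bsub>k+1\<^esub>(L_iso)\<close>, we have
  \<open>\<langle>L_iso, Z\<rangle> \<ge> \<lambda> \<epsilon>\<close>. For \<open>i\<close>, \<open>j\<close> in different clusters, positivity of \<open>Z\<close> on
  \<open>(I - P) (e\<^sub>i - e\<^sub>j)\<close> bounds \<open>Z\<^sub>i\<^sub>i + Z\<^sub>j\<^sub>j - 2 Z\<^sub>i\<^sub>j\<close> from below by its value at \<open>P\<close> minus off-block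
  masses of \<open>Z\<close>; weighting with \<open>w\<^sub>i\<^sub>j\<close> and summing, the cut edges cost at most \<open>4 \<parallel>D_\<delta>\<parallel> \<epsilon>\<close>. Hence
  \<open>\<langle>L, Z - P\<rangle> \<ge> (\<lambda> - 4 \<parallel>D_\<delta>\<parallel>) \<epsilon>\<close>, and \<open>\<epsilon> = 0\<close> forces \<open>Z = P\<close>. The formula for \<open>\<lambda>\<close> holds
  because \<open>\<lambda>\<^bsub>k+1\<^esub>(L_iso)\<close> is the largest \<open>\<mu>\<close> with \<open>L_iso \<succeq> \<mu> (I - P)\<close>, a condition that splits
  over the blocks.
\<close>

section \<open>Spectral decomposition of real symmetric matrices\<close>

lemma mat_mult_index_sum:
  assumes "A \<in> carrier_mat m n" "B \<in> carrier_mat n r" "i < m" "j < r"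
  shows "(A * B) $$ (i, j) = (\<Sum>l<n. A $$ (i, l) * B $$ (l, j))"
  using assms by (simp add: scalar_prod_def atLeast0LessThan)

lemma mat_vec_index_sum:
  assumes "A \<in> carrier_mat m n" "v \<in> carrier_vec n" "i < m"
  shows "(A *\<^sub>v v) $ i = (\<Sum>l<n. A $$ (i, l) * v $ l)"
  using assms by (simp add: scalar_prod_def atLeast0LessThan)

lemma transpose_mat_eqD:
  assumes "A \<in> carrier_mat n n" "transpose_mat A = A" "i < n" "j < n"
  shows "A $$ (i, j) = A $$ (j, i)"
  using assms by (metis carrier_matD index_transpose_mat(1))

text \<open>Over the complex numbers the characteristic polynomial has a root \<open>a\<close>. For
  an eigenvector \<open>u\<close> the Hermitian form \<open>S\<close> of \<open>A\<close> at
  \<open>u\<close> equals \<open>a\<close> times the squared norm of \<open>u\<close>. As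
  \<open>A\<close> is real and symmetric, \<open>S\<close> is its own conjugate, so \<open>a\<close>
  is real.\<close>

lemma symmetric_real_eigenvalue:
  fixes A :: "real mat"
  assumes A: "A \<in> carrier_mat n n" and sym: "transpose_mat A = A" and n: "0 < n"
  shows "\<exists>a. eigenvalue A a"
proof -
  define B where "B = map_mat complex_of_real A"
  have B: "B \<in> carrier_mat n n" using A by (simp add: B_def)
  obtain as where as: "char_poly B = (\<Prod>a\<leftarrow>as. [:- a, 1:])" "length as = n"
    using char_poly_factorized[OF B] by blast
  obtain a where "a \<in> set as" using as(2) n by (cases as) auto
  hence "poly (char_poly B) a = 0"
    by (simp add: as(1) poly_prod_list prod_list_zero_iff image_iff)
  hence "eigenvalue B a" using eigenvalue_root_char_poly[OF B] by simp
  then obtain u where u: "u \<in> carrier_vec n" "u \<noteq> 0\<^sub>v n" "B *\<^sub>v u = a \<cdot>\<^sub>v u"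
    using B unfolding eigenvalue_def eigenvector_def by auto
  have Bu: "(\<Sum>j<n. of_real (A $$ (i, j)) * u $ j) = a * u $ i" if "i < n" for i
  proof -
    have "(B *\<^sub>v u) $ i = (\<Sum>j<n. of_real (A $$ (i, j)) * u $ j)"
      using mat_vec_index_sum[OF B u(1) that] A that by (simp add: B_def)
    thus ?thesis using u that by simp
  qed
  define S where "S = (\<Sum>i<n. \<Sum>j<n. cnj (u $ i) * of_real (A $$ (i, j)) * u $ j)"
  have "cnj S = (\<Sum>i<n. \<Sum>j<n. u $ i * of_real (A $$ (i, j)) * cnj (u $ j))"
    by (simp add: S_def)
  also have "\<dots> = (\<Sum>j<n. \<Sum>i<n. u $ i * of_real (A $$ (i, j)) * cnj (u $ j))"
    by (rule sum.swap)
  also have "\<dots> = S"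
    unfolding S_def
    by (intro sum.cong refl) (simp add: transpose_mat_eqD[OF A sym] mult.commute mult.left_commute)
  finally have S_real: "cnj S = S" .
  define m where "m = (\<Sum>i<n. (cmod (u $ i))\<^sup>2)"
  have "S = (\<Sum>i<n. cnj (u $ i) * (\<Sum>j<n. of_real (A $$ (i, j)) * u $ j))"
    by (simp add: S_def sum_distrib_left mult.assoc)
  also have "\<dots> = (\<Sum>i<n. cnj (u $ i) * (a * u $ i))"
    using Bu by (intro sum.cong refl) auto
  also have "\<dots> = a * of_real m"
    unfolding m_def of_real_sum complex_norm_square by (simp add: sum_distrib_left algebra_simps)
  finally have S: "S = a * of_real m" .
  have "m \<noteq> 0"
  proof
    assume "m = 0"
    hence "\<forall>i\<in>{..<n}. (cmod (u $ i))\<^sup>2 = 0"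
      unfolding m_def by (subst sum_nonneg_eq_0_iff[symmetric]) auto
    hence "u = 0\<^sub>v n" using u(1) by (intro eq_vecI) auto
    thus False using u(2) by simp
  qed
  hence "cnj a = a" using S_real S by simp
  hence "a = of_real (Re a)" by (simp add: complex_eq_iff)
  \<comment> \<open>The characteristic polynomial commutes with the embedding of the reals, so the
    root found for \<open>B\<close> is a root for \<open>A\<close>.\<close>
  moreover have "poly (char_poly B) (of_real (Re a)) = of_real (poly (char_poly A) (Re a))"
    unfolding B_def of_real_hom.char_poly_hom[OF A] by simp
  ultimately have "poly (char_poly A) (Re a) = 0"
    using \<open>poly (char_poly B) a = 0\<close> by simp
  thus ?thesis using eigenvalue_root_char_poly[OF A] by blast
qed

lemma symmetric_unit_eigenvector:
  fixes A :: "real mat"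
  assumes A: "A \<in> carrier_mat n n" and sym: "transpose_mat A = A" and n: "0 < n"
  obtains v a where "v \<in> carrier_vec n" "A *\<^sub>v v = a \<cdot>\<^sub>v v" "(\<Sum>i<n. (v $ i)\<^sup>2) = 1"
proof -
  obtain a u where u: "u \<in> carrier_vec n" "u \<noteq> 0\<^sub>v n" "A *\<^sub>v u = a \<cdot>\<^sub>v u"
    using symmetric_real_eigenvalue[OF assms] A unfolding eigenvalue_def eigenvector_def by auto
  define s where "s = sqrt (\<Sum>i<n. (u $ i)\<^sup>2)"
  have "(\<Sum>i<n. (u $ i)\<^sup>2) \<noteq> 0"
  proof
    assume "(\<Sum>i<n. (u $ i)\<^sup>2) = 0"
    hence "\<forall>i\<in>{..<n}. (u $ i)\<^sup>2 = 0"
      by (subst sum_nonneg_eq_0_iff[symmetric]) auto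
    hence "u = 0\<^sub>v n" using u(1) by (intro eq_vecI) auto
    thus False using u(2) by simp
  qed
  moreover have "(\<Sum>i<n. (u $ i)\<^sup>2) \<ge> 0" by (intro sum_nonneg) auto
  ultimately have s: "s \<noteq> 0" "s\<^sup>2 = (\<Sum>i<n. (u $ i)\<^sup>2)" by (auto simp: s_def)
  show ?thesis
  proof (rule that[of "(1 / s) \<cdot>\<^sub>v u" a])
    show "(1 / s) \<cdot>\<^sub>v u \<in> carrier_vec n" using u by simp
    show "A *\<^sub>v ((1 / s) \<cdot>\<^sub>v u) = a \<cdot>\<^sub>v ((1 / s) \<cdot>\<^sub>v u)"
      using mult_mat_vec[OF A u(1), of "1 / s"] u(3) by (simp add: smult_smult_assoc mult.commute)
    have "(\<Sum>i<n. (((1 / s) \<cdot>\<^sub>v u) $ i)\<^sup>2) = (\<Sum>i<n. (u $ i)\<^sup>2) / s\<^sup>2"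
      using u(1) by (simp add: power_divide sum_divide_distrib)
    also have "\<dots> = 1" unfolding s(2)[symmetric] using s(1) by simp
    finally show "(\<Sum>i<n. (((1 / s) \<cdot>\<^sub>v u) $ i)\<^sup>2) = 1" .
  qed
qed

text \<open>\<open>H\<close> is the Householder reflection exchanging \<open>v\<close> and the first unit vector.\<close>
lemma symmetric_involution_first_column:
  fixes v :: "real vec"
  assumes v: "v \<in> carrier_vec (Suc n)" and norm: "(\<Sum>i<Suc n. (v $ i)\<^sup>2) = 1"
  obtains H where "H \<in> carrier_mat (Suc n) (Suc n)" "transpose_mat H = H" "H * H = 1\<^sub>m (Suc n)"
    "col H 0 = v"
proof (cases "v = unit_vec (Suc n) 0")
  case True
  show ?thesis by (rule that[of "1\<^sub>m (Suc n)"]) (auto simp: True)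
next
  case False
  define N where "N = Suc n"
  define w where "w i = v $ i - (if i = 0 then 1 else 0)" for i
  have sq: "(\<Sum>i<N. (w i)\<^sup>2) = 2 - 2 * v $ 0"
  proof -
    have "(\<Sum>i<N. (w i)\<^sup>2) = (\<Sum>i<N. (v $ i)\<^sup>2 + (if i = 0 then 1 - 2 * v $ i else 0))"
      by (intro sum.cong refl) (auto simp: w_def power2_eq_square algebra_simps)
    also have "\<dots> = 1 + (1 - 2 * v $ 0)"
      using norm by (simp add: sum.distrib N_def)
    finally show ?thesis by simp
  qed
  have "(\<Sum>i<N. (w i)\<^sup>2) \<noteq> 0"
  proof
    assume "(\<Sum>i<N. (w i)\<^sup>2) = 0"
    hence "\<forall>i\<in>{..<N}. (w i)\<^sup>2 = 0"
      by (subst sum_nonneg_eq_0_iff[symmetric]) auto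
    hence "v = unit_vec (Suc n) 0" using v by (intro eq_vecI) (auto simp: w_def N_def)
    thus False using False by simp
  qed
  hence v0: "1 - v $ 0 \<noteq> 0" using sq by simp
  define t where "t = 1 / (1 - v $ 0)"
  have t: "t * (\<Sum>i<N. (w i)\<^sup>2) = 2" unfolding sq t_def using v0 by (simp add: field_simps)
  have w0: "t * w 0 = -1" using v0 by (simp add: w_def t_def field_simps)
  define H where "H = mat N N (\<lambda>(i, j). (if i = j then 1 else 0) - t * w i * w j)"
  have H: "H \<in> carrier_mat N N" by (simp add: H_def)
  show ?thesis
  proof (rule that[of H])
    show "H \<in> carrier_mat (Suc n) (Suc n)" using H by (simp add: N_def)
    show "transpose_mat H = H" by (rule eq_matI) (auto simp: H_def)
    show "H * H = 1\<^sub>m (Suc n)"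
    proof (rule eq_matI)
      fix i j assume "i < dim_row (1\<^sub>m (Suc n))" "j < dim_col (1\<^sub>m (Suc n))"
      hence ij: "i < N" "j < N" by (auto simp: N_def)
      have "(H * H) $$ (i, j) = (\<Sum>l<N. H $$ (i, l) * H $$ (l, j))"
        by (rule mat_mult_index_sum[OF H H ij])
      also have "\<dots> = (\<Sum>l<N. ((if i = l then 1 else 0) - t * w i * w l)
                            * ((if l = j then 1 else 0) - t * w l * w j))"
        using ij by (intro sum.cong refl) (auto simp: H_def)
      also have "\<dots> = (\<Sum>l<N. (if l = i then (if i = j then 1 else 0) else 0)
           - (if l = i then t * w i * w j else 0) - (if l = j then t * w i * w j else 0)
           + t * w i * w j * (t * (w l)\<^sup>2))"
        by (intro sum.cong refl) (auto simp: algebra_simps power2_eq_square)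
      also have "\<dots> = (if i = j then 1 else 0) - t * w i * w j - t * w i * w j
                     + t * w i * w j * (t * (\<Sum>l<N. (w l)\<^sup>2))"
        using ij by (simp add: sum.distrib sum_subtractf flip: sum_distrib_left)
      also have "\<dots> = (if i = j then 1 else 0)" unfolding t by simp
      finally show "(H * H) $$ (i, j) = 1\<^sub>m (Suc n) $$ (i, j)" using ij by (simp add: N_def)
    qed (use H in \<open>auto simp: N_def\<close>)
    show "col H 0 = v"
    proof (rule eq_vecI)
      fix i assume "i < dim_vec v"
      hence i: "i < N" using v by (simp add: N_def)
      have "H $$ (i, 0) = (if i = 0 then 1 else 0) - w i * (t * w 0)"
        using i by (simp add: H_def)
      also have "\<dots> = v $ i" unfolding w0 by (simp add: w_def)
      finally show "col H 0 $ i = v $ i" using i H by (simp add: N_def)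
    qed (use H v in \<open>auto simp: N_def\<close>)
  qed
qed

text \<open>Induction on the size: a reflection \<open>H\<close> moves a unit eigenvector to the
  first axis. Symmetry then clears the first row of \<open>H * A * H\<close> along with its first
  column, which leaves a scalar and a symmetric block of size \<open>n\<close> for the induction
  hypothesis.\<close>

theorem symmetric_orthogonally_diagonalizable:
  fixes A :: "real mat"
  assumes "A \<in> carrier_mat n n" "transpose_mat A = A"
  shows "\<exists>Q D. Q \<in> carrier_mat n n \<and> D \<in> carrier_mat n n \<and> diagonal_mat D \<and>
           transpose_mat Q * Q = 1\<^sub>m n \<and> A = Q * D * transpose_mat Q"
  using assms
proof (induction n arbitrary: A)
  case 0
  show ?case by (rule exI[of _ "1\<^sub>m 0"], rule exI[of _ "1\<^sub>m 0"]) (use 0 in \<open>auto simp: diagonal_mat_def\<close>)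
next
  case (Suc n)
  note A = Suc.prems(1) and sym = Suc.prems(2)
  obtain v a where v: "v \<in> carrier_vec (Suc n)" "A *\<^sub>v v = a \<cdot>\<^sub>v v" "(\<Sum>i<Suc n. (v $ i)\<^sup>2) = 1"
    using symmetric_unit_eigenvector[OF A sym] by blast
  obtain H where H: "H \<in> carrier_mat (Suc n) (Suc n)" "transpose_mat H = H" "H * H = 1\<^sub>m (Suc n)"
    "col H 0 = v"
    using symmetric_involution_first_column[OF v(1,3)] by blast
  define B where "B = H * A * H"
  have B: "B \<in> carrier_mat (Suc n) (Suc n)" using A H by (simp add: B_def)
  have B_sym: "transpose_mat B = B"
    unfolding B_def using A H(1)
    by (simp add: transpose_mult[of _ "Suc n" "Suc n" _ "Suc n"] H(2) sym assoc_mult_mat[of _ "Suc n" "Suc n" _ "Suc n" _ "Suc n"])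
  have A_eq: "A = H * B * H"
  proof -
    have "H * B * H = (H * H) * A * (H * H)"
      unfolding B_def using A H(1) by (simp add: assoc_mult_mat[of _ "Suc n" "Suc n" _ "Suc n" _ "Suc n"])
    thus ?thesis using A H(3) by simp
  qed
  \<comment> \<open>Since \<open>H\<close> is an involution with first column \<open>v\<close>, it
    sends \<open>v\<close> back to the first unit vector.\<close>
  have colB: "col B 0 = a \<cdot>\<^sub>v unit_vec (Suc n) 0"
  proof -
    have "col B 0 = H *\<^sub>v (A *\<^sub>v v)"
      unfolding B_def using A H(1) v(1) col_mult2[of "H * A" "Suc n" "Suc n" H "Suc n" 0]
        assoc_mult_mat_vec[OF H(1) A v(1)] by (simp only: H(4) mult_carrier_mat zero_less_Suc)
    also have "\<dots> = a \<cdot>\<^sub>v (H *\<^sub>v v)" using v H(1) by (simp add: mult_mat_vec[of _ "Suc n" "Suc n"])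
    also have "H *\<^sub>v v = col (H * H) 0" using col_mult2[OF H(1) H(1), of 0] by (simp only: H(4) zero_less_Suc)
    also have "\<dots> = unit_vec (Suc n) 0" unfolding H(3) by simp
    finally show ?thesis .
  qed
  have Bi0: "B $$ (i, 0) = (if i = 0 then a else 0)" if "i < Suc n" for i
  proof -
    have "B $$ (i, 0) = col B 0 $ i" using B that by simp
    thus ?thesis using that by (simp add: colB)
  qed
  define C where "C = mat n n (\<lambda>(i, j). B $$ (Suc i, Suc j))"
  have C: "C \<in> carrier_mat n n" by (simp add: C_def)
  have C_sym: "transpose_mat C = C"
    by (rule eq_matI) (auto simp: C_def transpose_mat_eqD[OF B B_sym])
  obtain R E where RE: "R \<in> carrier_mat n n" "E \<in> carrier_mat n n" "diagonal_mat E"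
    "transpose_mat R * R = 1\<^sub>m n" "C = R * E * transpose_mat R"
    using Suc.IH[OF C C_sym] by blast
  \<comment> \<open>Matrices of this block shape are closed under products and transposes, so the
    factorization of \<open>C\<close> extends to \<open>B\<close> block by block.\<close>
  define F where "F a X = four_block_mat (mat 1 1 (\<lambda>_. a)) (0\<^sub>m 1 n) (0\<^sub>m n 1) X" for a :: real and X
  have F: "F x X \<in> carrier_mat (Suc n) (Suc n)" if "X \<in> carrier_mat n n" for x X
    using four_block_carrier_mat[of "mat 1 1 (\<lambda>_. x)" 1 1 X n n] that by (simp add: F_def)
  have F_mult: "F x X * F y Y = F (x * y) (X * Y)"
    if "X \<in> carrier_mat n n" "Y \<in> carrier_mat n n" for x y X Y
  proof -
    have 1: "mat 1 1 (\<lambda>_. x) * mat 1 1 (\<lambda>_. y) = mat 1 1 (\<lambda>_. x * y)"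
      by (rule eq_matI) (auto simp: scalar_prod_def)
    show ?thesis unfolding F_def
      by (subst mult_four_block_mat[of _ 1 1 _ n _ n _ _ 1 _ n]) (use that 1 in auto)
  qed
  have F_transpose: "transpose_mat (F x X) = F x (transpose_mat X)" if "X \<in> carrier_mat n n" for x X
  proof -
    have "transpose_mat (mat 1 1 (\<lambda>_. x)) = mat 1 1 (\<lambda>_. x)" by (rule eq_matI) auto
    thus ?thesis unfolding F_def
      by (subst transpose_four_block_mat[of _ 1 1 _ n _ n]) (use that in auto)
  qed
  have F_one: "F 1 (1\<^sub>m n) = 1\<^sub>m (Suc n)"
    by (rule eq_matI) (auto simp: F_def)
  have B_F: "B = F a C"
  proof (rule eq_matI)
    fix i j assume "i < dim_row (F a C)" "j < dim_col (F a C)"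
    hence ij: "i < Suc n" "j < Suc n" using F[OF C, of a] by auto
    show "B $$ (i, j) = F a C $$ (i, j)"
    proof (cases "j = 0")
      case True
      thus ?thesis using ij Bi0[of i] by (simp add: F_def C_def)
    next
      case False
      show ?thesis
      proof (cases "i = 0")
        case True
        hence "B $$ (i, j) = 0"
          using transpose_mat_eqD[OF B B_sym, of 0 j] Bi0[of j] ij False by simp
        thus ?thesis using ij False True by (simp add: F_def C_def)
      next
        case i: False
        thus ?thesis using ij False by (simp add: F_def C_def)
      qed
    qed
  qed (use B F[OF C, of a] in auto)
  define Q where "Q = H * F 1 R"
  have Rt: "transpose_mat R \<in> carrier_mat n n" using RE(1) by simp
  have FR: "F 1 R \<in> carrier_mat (Suc n) (Suc n)" "F 1 (transpose_mat R) \<in> carrier_mat (Suc n) (Suc n)"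
    "F a E \<in> carrier_mat (Suc n) (Suc n)"
    using F RE(1,2) Rt by auto
  have Q: "Q \<in> carrier_mat (Suc n) (Suc n)" using H(1) FR by (simp add: Q_def)
  have Qt: "transpose_mat Q = F 1 (transpose_mat R) * H"
    unfolding Q_def using transpose_mult[OF H(1) FR(1)] by (simp add: F_transpose RE(1) H(2))
  have "transpose_mat Q * Q = F 1 (transpose_mat R) * (H * H) * F 1 R"
    unfolding Qt unfolding Q_def using H(1) FR
    by (simp add: assoc_mult_mat[of _ "Suc n" "Suc n" _ "Suc n" _ "Suc n"])
  also have "\<dots> = F 1 (1\<^sub>m n)"
    using FR RE Rt by (simp add: H(3) F_mult)
  finally have QQ: "transpose_mat Q * Q = 1\<^sub>m (Suc n)" by (simp add: F_one)
  have "B = F 1 R * F a E * F 1 (transpose_mat R)"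
    using RE Rt by (simp add: B_F F_mult)
  hence "A = Q * F a E * transpose_mat Q"
    unfolding Qt unfolding Q_def A_eq using H(1) FR
    by (simp add: assoc_mult_mat[of _ "Suc n" "Suc n" _ "Suc n" _ "Suc n"])
  moreover have "diagonal_mat (F a E)"
    using RE(2,3) by (auto simp: diagonal_mat_def F_def)
  ultimately show ?case using Q FR(3) QQ by blast
qed

section \<open>Orthonormal eigenbases, with vectors and matrices as functions on indices\<close>

definition qform :: "nat \<Rightarrow> (nat \<Rightarrow> nat \<Rightarrow> real) \<Rightarrow> (nat \<Rightarrow> real) \<Rightarrow> real" where
  "qform n A v = (\<Sum>i<n. \<Sum>j<n. A i j * v i * v j)"

abbreviation (input) entries :: "real mat \<Rightarrow> nat \<Rightarrow> nat \<Rightarrow> real" where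
  "entries M \<equiv> \<lambda>i j. M $$ (i, j)"

text \<open>\<open>q i\<close> is an eigenvector for \<open>e i\<close>, as
  \<open>apply_eigenvector\<close> derives from \<open>decomp\<close>. \<open>orthonormal\<close>
  and \<open>complete\<close> express the orthogonality of the matrix \<open>q\<close> through its
  rows and through its columns.\<close>

locale eigenbasis =
  fixes n :: nat and A q :: "nat \<Rightarrow> nat \<Rightarrow> real" and e :: "nat \<Rightarrow> real"
  assumes orthonormal: "i < n \<Longrightarrow> j < n \<Longrightarrow> (\<Sum>l<n. q i l * q j l) = (if i = j then 1 else 0)"
    and complete: "l < n \<Longrightarrow> m < n \<Longrightarrow> (\<Sum>i<n. q i l * q i m) = (if l = m then 1 else 0)"
    and decomp: "l < n \<Longrightarrow> m < n \<Longrightarrow> A l m = (\<Sum>i<n. e i * q i l * q i m)"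
begin

lemma apply_eigenvector:
  assumes "i < n" "l < n"
  shows "(\<Sum>m<n. A l m * q i m) = e i * q i l"
proof -
  have "(\<Sum>m<n. A l m * q i m) = (\<Sum>m<n. \<Sum>j<n. e j * q j l * (q j m * q i m))"
    using assms by (intro sum.cong refl) (simp add: decomp sum_distrib_right mult.assoc)
  also have "\<dots> = (\<Sum>j<n. e j * q j l * (\<Sum>m<n. q j m * q i m))"
    by (subst sum.swap) (simp add: sum_distrib_left)
  also have "\<dots> = (\<Sum>j<n. if j = i then e j * q j l else 0)"
    using assms by (intro sum.cong refl) (simp add: orthonormal)
  also have "\<dots> = e i * q i l" using assms by simp
  finally show ?thesis .
qed

lemma qform_eq: "qform n A v = (\<Sum>i<n. e i * (\<Sum>l<n. v l * q i l)\<^sup>2)"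
proof -
  have "qform n A v = (\<Sum>l<n. \<Sum>m<n. \<Sum>i<n. e i * ((v l * q i l) * (v m * q i m)))"
    unfolding qform_def
    by (intro sum.cong refl) (simp add: decomp sum_distrib_left sum_distrib_right mult_ac)
  also have "\<dots> = (\<Sum>l<n. \<Sum>i<n. \<Sum>m<n. e i * ((v l * q i l) * (v m * q i m)))"
    by (intro sum.cong refl sum.swap)
  also have "\<dots> = (\<Sum>i<n. \<Sum>l<n. \<Sum>m<n. e i * ((v l * q i l) * (v m * q i m)))"
    by (rule sum.swap)
  also have "\<dots> = (\<Sum>i<n. e i * (\<Sum>l<n. v l * q i l)\<^sup>2)"
    unfolding power2_eq_square sum_product by (simp add: sum_distrib_left)
  finally show ?thesis .
qed

lemma parseval: "(\<Sum>l<n. (v l)\<^sup>2) = (\<Sum>i<n. (\<Sum>l<n. v l * q i l)\<^sup>2)"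
proof -
  have "(\<Sum>i<n. (\<Sum>l<n. v l * q i l)\<^sup>2) = (\<Sum>i<n. \<Sum>l<n. \<Sum>m<n. v l * v m * (q i l * q i m))"
    unfolding power2_eq_square sum_product by (simp add: mult_ac)
  also have "\<dots> = (\<Sum>l<n. \<Sum>i<n. \<Sum>m<n. v l * v m * (q i l * q i m))"
    by (rule sum.swap)
  also have "\<dots> = (\<Sum>l<n. \<Sum>m<n. \<Sum>i<n. v l * v m * (q i l * q i m))"
    by (intro sum.cong refl sum.swap)
  also have "\<dots> = (\<Sum>l<n. \<Sum>m<n. if m = l then v l * v m else 0)"
    by (intro sum.cong refl) (auto simp: complete simp flip: sum_distrib_left)
  also have "\<dots> = (\<Sum>l<n. (v l)\<^sup>2)" by (simp add: power2_eq_square)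
  finally show ?thesis by simp
qed

lemma qform_eigenvector:
  assumes "i < n"
  shows "qform n A (q i) = e i"
proof -
  have "qform n A (q i) = (\<Sum>l<n. q i l * (\<Sum>m<n. A l m * q i m))"
    unfolding qform_def by (simp add: sum_distrib_left mult_ac)
  also have "\<dots> = e i * (\<Sum>l<n. q i l * q i l)"
    using assms by (simp add: apply_eigenvector sum_distrib_left mult_ac)
  finally show ?thesis using assms by (simp add: orthonormal)
qed

lemma symmetric: "l < n \<Longrightarrow> m < n \<Longrightarrow> A l m = A m l"
  by (simp add: decomp mult_ac)

text \<open>Expanding only \<open>A\<close> leaves eigenvalues times values of the form of
  \<open>M\<close>, so that sign conditions on both factors can be used termwise.\<close>

lemma inner_eq: "(\<Sum>l<n. \<Sum>m<n. M l m * A l m) = (\<Sum>i<n. e i * qform n M (q i))"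
proof -
  have "(\<Sum>l<n. \<Sum>m<n. M l m * A l m) = (\<Sum>l<n. \<Sum>m<n. \<Sum>i<n. e i * (M l m * q i l * q i m))"
    by (intro sum.cong refl) (simp add: decomp sum_distrib_left mult_ac)
  also have "\<dots> = (\<Sum>l<n. \<Sum>i<n. \<Sum>m<n. e i * (M l m * q i l * q i m))"
    by (intro sum.cong refl sum.swap)
  also have "\<dots> = (\<Sum>i<n. \<Sum>l<n. \<Sum>m<n. e i * (M l m * q i l * q i m))"
    by (rule sum.swap)
  finally show ?thesis by (simp add: qform_def sum_distrib_left)
qed

text \<open>Invariance of the trace under a change of orthonormal basis; with a projection for
  \<open>M\<close> it serves to count eigenvectors.\<close>

lemma trace_eq: "(\<Sum>i<n. qform n M (q i)) = (\<Sum>l<n. M l l)"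
proof -
  have "(\<Sum>i<n. qform n M (q i)) = (\<Sum>l<n. \<Sum>i<n. \<Sum>m<n. M l m * (q i l * q i m))"
    unfolding qform_def by (subst sum.swap) (simp add: mult_ac)
  also have "\<dots> = (\<Sum>l<n. \<Sum>m<n. \<Sum>i<n. M l m * (q i l * q i m))"
    by (intro sum.cong refl sum.swap)
  also have "\<dots> = (\<Sum>l<n. \<Sum>m<n. if m = l then M l m else 0)"
    by (intro sum.cong refl) (auto simp: complete simp flip: sum_distrib_left)
  finally show ?thesis by simp
qed

end

lemma proots_linear_factors: "proots (\<Prod>a\<leftarrow>xs. [:- a, 1:]) = mset (xs :: 'a::idom list)"
proof (induction xs)
  case (Cons a xs)
  have "(\<Prod>a\<leftarrow>xs. [:- a, 1:]) \<noteq> (0 :: 'a poly)" by (auto simp: prod_list_zero_iff)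
  with Cons show ?case by (simp add: proots_mult del: mult_pCons_left)
qed simp

text \<open>The diagonalization yields the eigenvalues in some order, whereas \<open>eigval\<close>
  sorts the roots. One permutation \<open>p\<close> sorts the diagonal of \<open>D\<close> and
  relabels the columns of \<open>Q\<close>. The index of \<open>e\<close> starts at 0, that of
  \<open>eigval\<close> at 1.\<close>

lemma symmetric_eigenbasis:
  assumes A: "A \<in> carrier_mat n n" and sym: "transpose_mat A = A"
  obtains q e where "eigenbasis n (entries A) q e" "\<And>i j. i \<le> j \<Longrightarrow> j < n \<Longrightarrow> e i \<le> e j"
    "\<And>l. 1 \<le> l \<Longrightarrow> l \<le> n \<Longrightarrow> eigval l A = e (l - 1)"
proof -
  obtain Q D where Q: "Q \<in> carrier_mat n n" and D: "D \<in> carrier_mat n n" "diagonal_mat D"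
    and QQ: "transpose_mat Q * Q = 1\<^sub>m n" and A_eq: "A = Q * D * transpose_mat Q"
    using symmetric_orthogonally_diagonalizable[OF assms] by blast
  have Qt: "transpose_mat Q \<in> carrier_mat n n" using Q by simp
  have QQ': "Q * transpose_mat Q = 1\<^sub>m n" using mat_mult_left_right_inverse[OF Qt Q QQ] .
  have "similar_mat_wit A D Q (transpose_mat Q)"
    by (rule similar_mat_witI[OF QQ' QQ A_eq A D(1) Q Qt])
  hence "char_poly A = char_poly D"
    by (intro char_poly_similar) (auto simp: similar_mat_def)
  also have "\<dots> = (\<Prod>a\<leftarrow>diag_mat D. [:- a, 1:])"
    using D by (intro char_poly_upper_triangular) (auto simp: diagonal_mat_def upper_triangular_def)
  finally have "proots (char_poly A) = mset (diag_mat D)"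
    by (simp add: proots_linear_factors)
  define ds where "ds = diag_mat D"
  have ds: "length ds = n" "\<And>i. i < n \<Longrightarrow> ds ! i = D $$ (i, i)"
    using D by (auto simp: ds_def diag_mat_def)
  have eig: "eigval l A = sort ds ! (l - 1)" for l
    by (simp add: eigval_def \<open>proots (char_poly A) = _\<close> ds_def)
  obtain p where p: "p permutes {..<n}" "permute_list p ds = sort ds"
    using mset_eq_permutation[of "sort ds" ds] ds by auto
  define e where "e i = sort ds ! i" for i
  define q where "q i l = Q $$ (l, p i)" for i l
  have p_lt: "p i < n" if "i < n" for i using permutes_in_image[OF p(1), of i] that by simp
  have e: "e i = D $$ (p i, p i)" if "i < n" for i
    using that ds p permute_list_nth[of p ds i] p_lt[of i] by (simp add: e_def)
  have D_zero: "D $$ (i, j) = 0" if "i < n" "j < n" "i \<noteq> j" for i j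
    using that D by (auto simp: diagonal_mat_def)
  have A_index: "A $$ (l, m) = (\<Sum>i<n. D $$ (i, i) * Q $$ (l, i) * Q $$ (m, i))"
    if "l < n" "m < n" for l m
  proof -
    have "(Q * D) $$ (l, i) = D $$ (i, i) * Q $$ (l, i)" if "i < n" for i
    proof -
      have "(Q * D) $$ (l, i) = (\<Sum>j<n. Q $$ (l, j) * D $$ (j, i))"
        using mat_mult_index_sum[OF Q D(1) \<open>l < n\<close> that] .
      also have "\<dots> = (\<Sum>j<n. if j = i then D $$ (i, i) * Q $$ (l, i) else 0)"
        using that by (intro sum.cong refl) (auto simp: D_zero mult.commute)
      finally show ?thesis using that by simp
    qed
    thus ?thesis unfolding A_eq using Q D that
      by (subst mat_mult_index_sum[of _ n n _ n]) (auto intro!: sum.cong)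
  qed
  show ?thesis
  proof (rule that[of q e])
    show "eigenbasis n (entries A) q e"
    proof
      fix i j assume ij: "i < n" "j < n"
      have "(\<Sum>l<n. q i l * q j l) = (transpose_mat Q * Q) $$ (p i, p j)"
        using Q ij p_lt by (subst mat_mult_index_sum[OF Qt Q]) (auto simp: q_def)
      also have "\<dots> = (if i = j then 1 else 0)"
        unfolding QQ using ij p_lt permutes_inj[OF p(1)] by (auto simp: inj_eq)
      finally show "(\<Sum>l<n. q i l * q j l) = (if i = j then 1 else 0)" .
    next
      fix l m assume lm: "l < n" "m < n"
      have "(\<Sum>i<n. q i l * q i m) = (\<Sum>i<n. Q $$ (l, i) * Q $$ (m, i))"
        unfolding q_def using sum.permute[OF p(1), of "\<lambda>i. Q $$ (l, i) * Q $$ (m, i)"] by (simp add: o_def)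
      also have "\<dots> = (Q * transpose_mat Q) $$ (l, m)"
        using Q lm by (subst mat_mult_index_sum[OF Q Qt]) auto
      finally show "(\<Sum>i<n. q i l * q i m) = (if l = m then 1 else 0)"
        unfolding QQ' using lm by simp
      have "(\<Sum>i<n. e i * q i l * q i m) = (\<Sum>i<n. D $$ (p i, p i) * Q $$ (l, p i) * Q $$ (m, p i))"
        by (intro sum.cong refl) (simp add: e q_def)
      also have "\<dots> = A $$ (l, m)"
        using sum.permute[OF p(1), of "\<lambda>i. D $$ (i, i) * Q $$ (l, i) * Q $$ (m, i)"] lm
        by (simp add: o_def A_index)
      finally show "A $$ (l, m) = (\<Sum>i<n. e i * q i l * q i m)" by simp
    qed
    show "e i \<le> e j" if "i \<le> j" "j < n" for i j
      using that ds by (auto simp: e_def intro!: sorted_nth_mono)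
    show "eigval l A = e (l - 1)" if "1 \<le> l" "l \<le> n" for l
      by (simp add: eig e_def)
  qed
qed

section \<open>Eigenvalues beyond a known part of the kernel\<close>

text \<open>Eigenvectors of \<open>A\<close> for positive eigenvalues are killed by \<open>P\<close>, and \<open>\<langle>q, P q\<rangle> \<le> 1\<close> for the
  others, so both directions follow by counting the trace of \<open>P\<close>.\<close>
lemma le_eigval_iff:
  assumes A: "A \<in> carrier_mat n n" and sym: "transpose_mat A = A"
    and nonneg: "\<And>v. 0 \<le> qform n (entries A) v"
    and P_sym: "\<And>l m. l < n \<Longrightarrow> m < n \<Longrightarrow> P l m = P m l"
    and P_idem: "\<And>l m. l < n \<Longrightarrow> m < n \<Longrightarrow> (\<Sum>r<n. P l r * P r m) = P l m"
    and P_trace: "(\<Sum>l<n. P l l) = real k" and k: "k < n"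
    and AP: "\<And>l m. l < n \<Longrightarrow> m < n \<Longrightarrow> (\<Sum>r<n. A $$ (l, r) * P r m) = 0"
    and \<mu>: "0 \<le> \<mu>"
  shows "\<mu> \<le> eigval (k + 1) A \<longleftrightarrow>
    (\<forall>v. \<mu> * ((\<Sum>l<n. (v l)\<^sup>2) - qform n P v) \<le> qform n (entries A) v)"
proof -
  obtain q e where "eigenbasis n (entries A) q e"
    and mono: "\<And>i j. i \<le> j \<Longrightarrow> j < n \<Longrightarrow> e i \<le> e j"
    and eig: "\<And>l. 1 \<le> l \<Longrightarrow> l \<le> n \<Longrightarrow> eigval l A = e (l - 1)"
    using symmetric_eigenbasis[OF A sym] by metis
  then interpret eigenbasis n "entries A" q e by simp
  have eig_k: "eigval (k + 1) A = e k" using eig[of "k + 1"] k by simp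
  have e_nonneg: "0 \<le> e i" if "i < n" for i
    using nonneg[of "q i"] qform_eigenvector[OF that] by simp
  define Pq where "Pq i l = (\<Sum>m<n. P l m * q i m)" for i l
  define d where "d i = qform n P (q i)" for i
  \<comment> \<open>Transposing \<open>AP\<close> shows that the product of \<open>P\<close> with
    \<open>A\<close> vanishes as well; applied to \<open>q i\<close>, this annihilates
    \<open>e i\<close> times the projected eigenvector.\<close>
  have Pq_zero: "Pq i l = 0" if "i < n" "l < n" "e i \<noteq> 0" for i l
  proof -
    have "e i * Pq i l = (\<Sum>m<n. P l m * (e i * q i m))"
      by (simp add: Pq_def sum_distrib_left mult_ac)
    also have "\<dots> = (\<Sum>m<n. P l m * (\<Sum>r<n. A $$ (m, r) * q i r))"
      using that by (intro sum.cong refl) (simp add: apply_eigenvector)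
    also have "\<dots> = (\<Sum>r<n. q i r * (\<Sum>m<n. P l m * A $$ (m, r)))"
      by (simp add: sum_distrib_left mult_ac) (subst sum.swap, simp add: mult_ac)
    also have "\<dots> = (\<Sum>r<n. q i r * (\<Sum>m<n. A $$ (r, m) * P m l))"
    proof (rule sum.cong[OF refl])
      fix r assume "r \<in> {..<n}"
      hence "(\<Sum>m<n. P l m * A $$ (m, r)) = (\<Sum>m<n. A $$ (r, m) * P m l)"
        using P_sym[of l] symmetric[of _ r] that by (intro sum.cong refl) simp
      thus "q i r * (\<Sum>m<n. P l m * A $$ (m, r)) = q i r * (\<Sum>m<n. A $$ (r, m) * P m l)"
        by simp
    qed
    also have "\<dots> = 0" using that by (simp add: AP)
    finally show ?thesis using that by simp
  qed
  have d_eq: "d i = (\<Sum>l<n. q i l * Pq i l)" for i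
    by (simp add: d_def qform_def Pq_def sum_distrib_left mult_ac)
  \<comment> \<open>As \<open>P\<close> is symmetric and idempotent, \<open>d i\<close> is also the
    squared norm of the projection of \<open>q i\<close>. Together with the complementary norm in
    \<open>one_minus_d\<close> this places \<open>d i\<close> between 0 and 1.\<close>
  have d_eq2: "d i = (\<Sum>l<n. (Pq i l)\<^sup>2)" for i
  proof -
    have "(\<Sum>l<n. (Pq i l)\<^sup>2) = (\<Sum>l<n. \<Sum>r<n. \<Sum>m<n. P l r * q i r * (P l m * q i m))"
      by (simp add: Pq_def power2_eq_square sum_product)
    also have "\<dots> = (\<Sum>r<n. \<Sum>l<n. \<Sum>m<n. P l r * q i r * (P l m * q i m))" by (rule sum.swap)
    also have "\<dots> = (\<Sum>r<n. \<Sum>m<n. \<Sum>l<n. P l r * q i r * (P l m * q i m))"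
      by (intro sum.cong refl sum.swap)
    also have "\<dots> = (\<Sum>r<n. \<Sum>m<n. q i r * q i m * (\<Sum>l<n. P r l * P l m))"
      by (intro sum.cong refl) (simp add: sum_distrib_left P_sym mult_ac)
    also have "\<dots> = d i" by (simp add: d_def qform_def P_idem mult_ac)
    finally show ?thesis by simp
  qed
  have d_nonneg: "0 \<le> d i" for i by (simp add: d_eq2 sum_nonneg)
  have one_minus_d: "1 - d i = (\<Sum>l<n. (q i l - Pq i l)\<^sup>2)" if "i < n" for i
  proof -
    have "(\<Sum>l<n. (q i l - Pq i l)\<^sup>2) = (\<Sum>l<n. q i l * q i l) - 2 * (\<Sum>l<n. q i l * Pq i l)
        + (\<Sum>l<n. (Pq i l)\<^sup>2)"
      unfolding sum_distrib_left sum_subtractf[symmetric] sum.distrib[symmetric]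
      by (intro sum.cong refl) (simp add: power2_eq_square algebra_simps)
    thus ?thesis using that d_eq[of i] d_eq2[of i] by (simp add: orthonormal)
  qed
  have d_le: "d i \<le> 1" if "i < n" for i
    using one_minus_d[OF that] sum_nonneg[of "{..<n}" "\<lambda>l. (q i l - Pq i l)\<^sup>2"] by simp
  have d_zero: "d i = 0" if "i < n" "e i \<noteq> 0" for i
    using that by (simp add: d_eq Pq_zero)
  have d_sum: "(\<Sum>i<n. d i) = real k" unfolding d_def trace_eq by (rule P_trace)
  show ?thesis unfolding eig_k
  proof (intro iffI allI)
    fix v assume le: "\<mu> \<le> e k"
    show "\<mu> * ((\<Sum>l<n. (v l)\<^sup>2) - qform n P v) \<le> qform n (entries A) v"
    proof (cases "e k = 0")
      \<comment> \<open>Here \<mu> is 0 as well, so only nonnegativity of the form is left. In the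
        other case all eigenvalues from index \<open>k\<close> on are nonzero.\<close>
      case True
      thus ?thesis using le \<mu> nonneg[of v] by simp
    next
      case False
      hence pos: "e i \<noteq> 0" if "k \<le> i" "i < n" for i
        using e_nonneg[OF k] mono[OF that] by simp
      define a where "a i = (\<Sum>l<n. v l * q i l)" for i
      have split: "sum f {..<n} = sum f {..<k} + sum f {k..<n}" for f :: "nat \<Rightarrow> real"
        using k by (subst sum.union_disjoint[symmetric]) (auto intro!: sum.cong)
      \<comment> \<open>The \<open>d i\<close> sum to \<open>k\<close>, vanish from index
        \<open>k\<close> on and are at most 1. Hence the first \<open>k\<close> of them equal 1, and
        \<open>P\<close> fixes these eigenvectors.\<close>
      have "(\<Sum>i\<in>{k..<n}. d i) = 0" using pos by (intro sum.neutral) (auto simp: d_zero)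
      hence "(\<Sum>i<k. 1 - d i) = 0" using d_sum by (simp add: split sum_subtractf)
      hence "d i = 1" if "i < k" for i
        using that k d_le by (subst (asm) sum_nonneg_eq_0_iff) auto
      hence "(\<Sum>l<n. (q i l - Pq i l)\<^sup>2) = 0" if "i < k" for i
        using one_minus_d[of i] that k by simp
      hence fix_q: "Pq i l = q i l" if "i < k" "l < n" for i l
        using that by (subst (asm) sum_nonneg_eq_0_iff) auto
      \<comment> \<open>Thus \<open>P\<close> is the spectral projection of the first
        \<open>k\<close> eigenvectors, and its complement sees only eigenvalues that are at least
        \<open>e k\<close>.\<close>
      have P_eq: "P l m = (\<Sum>i<k. q i l * q i m)" if "l < n" "m < n" for l m
      proof -
        have "P l m = (\<Sum>r<n. if r = m then P l r else 0)" using that by simp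
        also have "\<dots> = (\<Sum>r<n. P l r * (\<Sum>i<n. q i r * q i m))"
          using that by (intro sum.cong refl) (simp add: complete)
        also have "\<dots> = (\<Sum>i<n. Pq i l * q i m)"
          by (simp add: Pq_def sum_distrib_left sum_distrib_right) (subst sum.swap, simp add: mult_ac)
        also have "\<dots> = (\<Sum>i<k. q i l * q i m)"
        proof -
          have "(\<Sum>i\<in>{k..<n}. Pq i l * q i m) = 0"
            using that pos by (intro sum.neutral) (auto simp: Pq_zero)
          thus ?thesis using that by (simp add: split fix_q)
        qed
        finally show ?thesis .
      qed
      have "qform n P v = (\<Sum>l<n. \<Sum>m<n. \<Sum>i<k. (v l * q i l) * (v m * q i m))"
        unfolding qform_def
        by (intro sum.cong refl) (simp add: P_eq sum_distrib_left sum_distrib_right mult_ac)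
      also have "\<dots> = (\<Sum>l<n. \<Sum>i<k. \<Sum>m<n. (v l * q i l) * (v m * q i m))"
        by (intro sum.cong refl sum.swap)
      also have "\<dots> = (\<Sum>i<k. \<Sum>l<n. \<Sum>m<n. (v l * q i l) * (v m * q i m))"
        by (rule sum.swap)
      also have "\<dots> = (\<Sum>i<k. (a i)\<^sup>2)"
        by (simp add: a_def power2_eq_square sum_product)
      finally have "\<mu> * ((\<Sum>l<n. (v l)\<^sup>2) - qform n P v) = \<mu> * (\<Sum>i\<in>{k..<n}. (a i)\<^sup>2)"
        unfolding parseval[of v] a_def[symmetric] by (simp add: split)
      also have "\<dots> \<le> (\<Sum>i\<in>{k..<n}. e i * (a i)\<^sup>2)"
        unfolding sum_distrib_left
      proof (intro sum_mono mult_right_mono)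
        fix i assume "i \<in> {k..<n}"
        thus "\<mu> \<le> e i" using le mono[of k i] by simp
      qed auto
      also have "\<dots> \<le> (\<Sum>i<n. e i * (a i)\<^sup>2)"
        unfolding split using e_nonneg k by (auto intro!: sum_nonneg mult_nonneg_nonneg)
      finally show ?thesis by (simp add: qform_eq a_def)
    qed
  next
    assume *: "\<forall>v. \<mu> * ((\<Sum>l<n. (v l)\<^sup>2) - qform n P v) \<le> qform n (entries A) v"
    show "\<mu> \<le> e k"
    proof (rule ccontr)
      assume "\<not> \<mu> \<le> e k"
      \<comment> \<open>Testing the inequality on each of the first \<open>k + 1\<close>
        eigenvectors forces \<open>e i = 0\<close> and then \<open>d i\<close> at least 1, so the
        trace of \<open>P\<close> would exceed \<open>k\<close>.\<close>
      hence "1 \<le> d i" if "i < Suc k" for i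
      proof -
        have i: "i < n" using that k by simp
        have lt: "e i < \<mu>" using mono[of i k] that k \<open>\<not> \<mu> \<le> e k\<close> by simp
        have le: "\<mu> * (1 - d i) \<le> e i"
          using spec[OF *, of "q i"] qform_eigenvector[OF i] orthonormal[OF i i]
          by (simp add: d_def power2_eq_square)
        have "e i = 0" using le lt by (cases "e i = 0") (simp_all add: d_zero[OF i])
        hence "\<mu> * (1 - d i) \<le> 0" "0 < \<mu>" using le lt by auto
        thus ?thesis by (simp add: mult_le_0_iff)
      qed
      hence "(\<Sum>i<Suc k. 1) \<le> (\<Sum>i<Suc k. d i)" by (intro sum_mono) auto
      also have "\<dots> \<le> (\<Sum>i<n. d i)" using k d_nonneg by (intro sum_mono2) auto
      finally show False by (simp add: d_sum)
    qed
  qed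
qed

section \<open>Positive semidefinite matrices through their eigenbases\<close>

lemma psd_qform_nonneg:
  assumes "psd Z" "Z \<in> carrier_mat n n"
  shows "0 \<le> qform n (entries Z) v"
proof -
  have "0 \<le> vec n v \<bullet> (Z *\<^sub>v vec n v)" using assms by (auto simp: psd_def)
  also have "\<dots> = qform n (entries Z) v"
    using assms(2) by (simp add: scalar_prod_def qform_def atLeast0LessThan sum_distrib_left mult_ac)
  finally show ?thesis .
qed

text \<open>By \<open>inner_eq\<close> the sum consists of eigenvalues of \<open>Z\<close> times
  values of the form of \<open>M\<close>, all of them nonnegative.\<close>

lemma psd_inner_nonneg:
  assumes "psd Z" "Z \<in> carrier_mat n n" "\<And>v. 0 \<le> qform n M v"
  shows "0 \<le> (\<Sum>i<n. \<Sum>j<n. M i j * Z $$ (i, j))"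
proof -
  have "transpose_mat Z = Z" using assms(1) by (simp add: psd_def)
  then obtain q e where "eigenbasis n (entries Z) q e"
    using symmetric_eigenbasis[OF assms(2)] by metis
  then interpret eigenbasis n "entries Z" q e .
  have "0 \<le> e i" if "i < n" for i
    using psd_qform_nonneg[OF assms(1,2), of "q i"] qform_eigenvector[OF that] by simp
  thus ?thesis unfolding inner_eq using assms(3) by (intro sum_nonneg mult_nonneg_nonneg) auto
qed

text \<open>In an eigenbasis the form is a sum of nonnegative terms. All of them vanish, hence so
  does \<open>e i\<close> times the coefficient of \<open>v\<close> along \<open>q i\<close>, which
  is a coefficient of the image of \<open>v\<close>.\<close>

lemma psd_qform_zero_imp_kernel:
  assumes "psd Z" "Z \<in> carrier_mat n n" "qform n (entries Z) v = 0" "l < n"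
  shows "(\<Sum>m<n. Z $$ (l, m) * v m) = 0"
proof -
  have "transpose_mat Z = Z" using assms(1) by (simp add: psd_def)
  then obtain q e where "eigenbasis n (entries Z) q e"
    using symmetric_eigenbasis[OF assms(2)] by metis
  then interpret eigenbasis n "entries Z" q e .
  have "0 \<le> e i" if "i < n" for i
    using psd_qform_nonneg[OF assms(1,2), of "q i"] qform_eigenvector[OF that] by simp
  hence *: "e i * (\<Sum>m<n. v m * q i m) = 0" if "i < n" for i
    using assms(3) that unfolding qform_eq by (subst (asm) sum_nonneg_eq_0_iff) auto
  have "(\<Sum>m<n. Z $$ (l, m) * v m) = (\<Sum>m<n. \<Sum>i<n. q i l * (e i * (v m * q i m)))"
    using assms(4) by (intro sum.cong refl) (simp add: decomp sum_distrib_left sum_distrib_right mult_ac)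
  also have "\<dots> = (\<Sum>i<n. q i l * (e i * (\<Sum>m<n. v m * q i m)))"
    by (subst sum.swap) (simp add: sum_distrib_left)
  also have "\<dots> = 0" by (rule sum.neutral) (use * in auto)
  finally show ?thesis .
qed

section \<open>Cluster projections and the semidefinite program\<close>

definition lap :: "nat \<Rightarrow> (nat \<Rightarrow> nat \<Rightarrow> real) \<Rightarrow> nat \<Rightarrow> nat \<Rightarrow> real" where
  "lap n w i j = (if i = j then \<Sum>l<n. w i l else 0) - w i j"

lemma sum_lap_mult:
  assumes "i < n"
  shows "(\<Sum>j<n. lap n w i j * f j) = (\<Sum>j<n. w i j * (f i - f j))"
proof -
  have "(\<Sum>j<n. lap n w i j * f j) = (\<Sum>j<n. (if j = i then (\<Sum>l<n. w i l) * f i else 0) - w i j * f j)"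
    by (intro sum.cong refl) (auto simp: lap_def algebra_simps)
  also have "\<dots> = (\<Sum>l<n. w i l) * f i - (\<Sum>j<n. w i j * f j)"
    using assms by (simp add: sum_subtractf)
  finally show ?thesis by (simp add: sum_distrib_right right_diff_distrib sum_subtractf)
qed

text \<open>The edge form of the objective; it can be split into edges inside clusters and cut
  edges.\<close>

lemma lap_inner: "(\<Sum>i<n. \<Sum>j<n. lap n w i j * Z i j) = (\<Sum>i<n. \<Sum>j<n. w i j * (Z i i - Z i j))"
  by (rule sum.cong[OF refl]) (simp add: sum_lap_mult)

lemma sum_weights_swap:
  fixes w :: "nat \<Rightarrow> nat \<Rightarrow> real"
  assumes "\<And>i j. i < n \<Longrightarrow> j < n \<Longrightarrow> w i j = w j i"
  shows "(\<Sum>i<n. \<Sum>j<n. w i j * f j i) = (\<Sum>i<n. \<Sum>j<n. w i j * f i j)"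
  by (subst sum.swap) (intro sum.cong refl, simp add: assms)

text \<open>Add the edge form to its copy with exchanged endpoints. The factor 2 reflects that each
  edge occurs in both directions.\<close>

lemma lap_qform:
  assumes "\<And>i j. i < n \<Longrightarrow> j < n \<Longrightarrow> w i j = w j i"
  shows "2 * qform n (lap n w) v = (\<Sum>i<n. \<Sum>j<n. w i j * (v i - v j)\<^sup>2)"
proof -
  have "qform n (lap n w) v = (\<Sum>i<n. \<Sum>j<n. w i j * (v i * v i - v i * v j))"
    using lap_inner[of n w "\<lambda>i j. v i * v j"] by (simp add: qform_def mult.assoc)
  moreover have "\<dots> = (\<Sum>i<n. \<Sum>j<n. w i j * (v j * v j - v j * v i))"
    using sum_weights_swap[OF assms, where f = "\<lambda>i j. v i * v i - v i * v j"] by simp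
  ultimately have "2 * qform n (lap n w) v = (\<Sum>i<n. \<Sum>j<n. w i j * (v i * v i - v i * v j))
      + (\<Sum>i<n. \<Sum>j<n. w i j * (v j * v j - v j * v i))" by simp
  also have "\<dots> = (\<Sum>i<n. \<Sum>j<n. w i j * (v i - v j)\<^sup>2)"
    by (simp add: sum.distrib[symmetric] power2_eq_square algebra_simps)
  finally show ?thesis .
qed

lemma lap_qform_nonneg:
  assumes "\<And>i j. i < n \<Longrightarrow> j < n \<Longrightarrow> 0 \<le> w i j"
    and "\<And>i j. i < n \<Longrightarrow> j < n \<Longrightarrow> w i j = w j i"
  shows "0 \<le> qform n (lap n w) v"
proof -
  have "0 \<le> (\<Sum>i<n. \<Sum>j<n. w i j * (v i - v j)\<^sup>2)"
    using assms(1) by (intro sum_nonneg mult_nonneg_nonneg) auto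
  thus ?thesis using lap_qform[of n w v] assms(2) by simp
qed

section \<open>The projection onto the cluster indicators\<close>

text \<open>The partition is encoded as a labelling, so that lying in one cluster is the equation
  \<open>c i = c j\<close>. By \<open>c_onto\<close> no cluster is empty.\<close>

locale clustering =
  fixes N k :: nat and c :: "nat \<Rightarrow> nat"
  assumes c_range: "i < N \<Longrightarrow> c i \<in> {1..k}"
    and c_onto: "a \<in> {1..k} \<Longrightarrow> \<exists>i<N. c i = a"
begin

definition csize :: "nat \<Rightarrow> real" where
  "csize i = real (card {j\<in>{..<N}. c j = c i})"

text \<open>These are the entries of \<open>X_rcut\<close>, that is, of the projection P of the
  overview.\<close>

definition proj :: "nat \<Rightarrow> nat \<Rightarrow> real" where
  "proj i j = (if c i = c j then 1 / csize i else 0)"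

lemma csize_pos: "i < N \<Longrightarrow> 0 < csize i"
  by (auto simp: csize_def card_gt_0_iff)

lemma proj_sym: "proj i j = proj j i"
  by (auto simp: proj_def csize_def)

lemma proj_nonneg: "0 \<le> proj i j"
  by (simp add: proj_def csize_def)

lemma proj_le_diag: "proj i j \<le> proj i i"
  by (simp add: proj_def csize_def)

lemma proj_le_diag': "proj i j \<le> proj j j"
  using proj_le_diag[of j i] by (simp add: proj_sym)

lemma sum_same_cluster: "(\<Sum>j<N. if c i = c j then x else 0) = csize i * x"
proof -
  have "(\<Sum>j<N. if c i = c j then x else 0) = (\<Sum>j\<in>{j\<in>{..<N}. c j = c i}. x)"
    by (rule sum.mono_neutral_cong_right) auto
  thus ?thesis by (simp add: csize_def)
qed

lemma proj_row: "i < N \<Longrightarrow> (\<Sum>j<N. proj i j) = 1"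
  using csize_pos[of i] by (simp add: proj_def sum_same_cluster)

lemma proj_idem:
  assumes "i < N"
  shows "(\<Sum>j<N. proj i j * proj j l) = proj i l"
proof -
  have "(\<Sum>j<N. proj i j * proj j l) = (\<Sum>j<N. proj i j * proj i l)"
    by (intro sum.cong refl) (auto simp: proj_def csize_def)
  thus ?thesis using proj_row[OF assms] by (simp flip: sum_distrib_right)
qed

text \<open>Each of the \<open>k\<close> nonempty clusters contributes its size times the reciprocal
  of its size.\<close>

lemma proj_trace: "(\<Sum>i<N. proj i i) = real k"
proof -
  have "(\<Sum>i<N. proj i i) = (\<Sum>a\<in>{1..k}. \<Sum>i\<in>{i\<in>{..<N}. c i = a}. proj i i)"
    using c_range by (intro sum.group[symmetric]) auto
  also have "\<dots> = (\<Sum>a\<in>{1..k}. 1)"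
  proof (intro sum.cong refl)
    fix a assume "a \<in> {1..k}"
    then obtain i where i: "i < N" "c i = a" using c_onto by blast
    have "(\<Sum>i\<in>{i\<in>{..<N}. c i = a}. proj i i) = (\<Sum>j\<in>{j\<in>{..<N}. c j = c i}. 1 / csize i)"
      by (rule sum.cong) (auto simp: proj_def csize_def i(2))
    also have "\<dots> = 1"
      unfolding sum_constant csize_def[symmetric] using csize_pos[OF i(1)] by simp
    finally show "(\<Sum>i\<in>{i\<in>{..<N}. c i = a}. proj i i) = 1" .
  qed
  finally show ?thesis by simp
qed

text \<open>P is its transpose times itself, so its form is a squared norm; this makes
  \<open>X_rcut\<close> positive semidefinite.\<close>

lemma qform_proj: "qform N proj v = (\<Sum>i<N. (\<Sum>j<N. proj i j * v j)\<^sup>2)"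
proof -
  have "(\<Sum>i<N. (\<Sum>j<N. proj i j * v j)\<^sup>2) = (\<Sum>i<N. \<Sum>j<N. \<Sum>l<N. v j * v l * (proj j i * proj i l))"
    unfolding power2_eq_square sum_product
  proof (intro sum.cong refl)
    fix i j l show "proj i j * v j * (proj i l * v l) = v j * v l * (proj j i * proj i l)"
      by (subst proj_sym[of i j]) simp
  qed
  also have "\<dots> = (\<Sum>j<N. \<Sum>i<N. \<Sum>l<N. v j * v l * (proj j i * proj i l))" by (rule sum.swap)
  also have "\<dots> = (\<Sum>j<N. \<Sum>l<N. \<Sum>i<N. v j * v l * (proj j i * proj i l))"
    by (intro sum.cong refl sum.swap)
  also have "\<dots> = qform N proj v"
    unfolding qform_def by (intro sum.cong refl) (simp add: proj_idem mult_ac flip: sum_distrib_left)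
  finally show ?thesis by simp
qed

text \<open>For \<open>w\<close> the entries of \<open>W\<close>, these are the entries of
  \<open>iso_mat\<close>, while the row sums of \<open>cut_weight w\<close> form the diagonal of
  \<open>D_delta\<close>.\<close>

definition inner_weight :: "(nat \<Rightarrow> nat \<Rightarrow> real) \<Rightarrow> nat \<Rightarrow> nat \<Rightarrow> real" where
  "inner_weight w i j = (if c i = c j then w i j else 0)"

definition cut_weight :: "(nat \<Rightarrow> nat \<Rightarrow> real) \<Rightarrow> nat \<Rightarrow> nat \<Rightarrow> real" where
  "cut_weight w i j = (if c i = c j then 0 else w i j)"

text \<open>The columns of \<open>proj\<close> are constant on clusters, so their differences along
  inner edges vanish. This is the part of the kernel that \<open>le_eigval_iff\<close> asks
  for.\<close>

lemma lap_inner_weight_proj: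
  assumes "i < N"
  shows "(\<Sum>j<N. lap N (inner_weight w) i j * proj j l) = 0"
  unfolding sum_lap_mult[OF assms]
  by (intro sum.neutral) (auto simp: inner_weight_def proj_def csize_def)

end

section \<open>Estimates for a feasible matrix\<close>

locale clustering_sdp = clustering +
  fixes Z :: "real mat"
  assumes feasible: "sdp_feasible N k Z"
begin

abbreviation z :: "nat \<Rightarrow> nat \<Rightarrow> real" where
  "z \<equiv> entries Z"

lemma Z_carrier: "Z \<in> carrier_mat N N" and Z_psd: "psd Z"
  using feasible by (auto simp: sdp_feasible_def)

lemma z_sym: "i < N \<Longrightarrow> j < N \<Longrightarrow> z i j = z j i"
  using feasible transpose_mat_eqD[of Z N i j] by (simp add: sdp_feasible_def)

lemma z_nonneg: "i < N \<Longrightarrow> j < N \<Longrightarrow> 0 \<le> z i j"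
  using feasible by (simp add: sdp_feasible_def)

lemma z_trace: "(\<Sum>i<N. z i i) = real k"
  using feasible Z_carrier by (simp add: sdp_feasible_def trace_mat_def)

lemma z_row:
  assumes "i < N"
  shows "(\<Sum>j<N. z i j) = 1"
proof -
  have "(Z *\<^sub>v ones_vec N) $ i = (\<Sum>j<N. z i j)"
    using mat_vec_index_sum[OF Z_carrier _ assms, of "ones_vec N"] by (simp add: ones_vec_def)
  thus ?thesis using feasible assms by (simp add: sdp_feasible_def ones_vec_def)
qed

text \<open>The rows of \<open>Z\<close> are probability vectors; this is the mass that row
  \<open>i\<close> puts outside the cluster of \<open>i\<close>.\<close>

definition outside :: "nat \<Rightarrow> real" where
  "outside i = (\<Sum>j<N. if c i = c j then 0 else z i j)"

text \<open>\<open>\<langle>I - P, Z\<rangle>\<close> for the projection \<open>P\<close> onto the cluster indicators.\<close>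
definition defect :: real where
  "defect = (\<Sum>i<N. proj i i * outside i)"

lemma outside_nonneg: "i < N \<Longrightarrow> 0 \<le> outside i"
  by (auto simp: outside_def intro!: sum_nonneg z_nonneg)

lemma defect_nonneg: "0 \<le> defect"
  by (auto simp: defect_def intro!: sum_nonneg mult_nonneg_nonneg proj_nonneg outside_nonneg)

lemma sum_proj_z:
  assumes "i < N"
  shows "(\<Sum>j<N. proj i j * z i j) = proj i i * (1 - outside i)"
proof -
  have "1 - outside i = (\<Sum>j<N. if c i = c j then z i j else 0)"
    unfolding outside_def z_row[OF assms, symmetric] sum_subtractf[symmetric]
    by (intro sum.cong refl) simp
  moreover have "(\<Sum>j<N. proj i j * z i j) = (\<Sum>j<N. proj i i * (if c i = c j then z i j else 0))"
    by (intro sum.cong refl) (simp add: proj_def)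
  ultimately show ?thesis by (simp add: sum_distrib_left)
qed

text \<open>Inside a cluster \<open>proj i j\<close> does not depend on \<open>j\<close>, so each
  row contributes \<open>proj i i\<close> times the mass kept inside. Both \<open>Z\<close> and P
  have trace \<open>k\<close>.\<close>

lemma defect_eq: "defect = (\<Sum>i<N. z i i) - (\<Sum>i<N. \<Sum>j<N. proj i j * z i j)"
proof -
  have "(\<Sum>i<N. \<Sum>j<N. proj i j * z i j) = (\<Sum>i<N. proj i i * (1 - outside i))"
    by (intro sum.cong refl) (simp add: sum_proj_z)
  also have "\<dots> = real k - defect"
    by (simp add: defect_def algebra_simps sum_subtractf proj_trace)
  finally show ?thesis by (simp add: z_trace)
qed

text \<open>Entry (i, j) of (I - P) Z (I - P), multiplied out.\<close>

lemma bilinear_unit_minus_proj: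
  assumes "i < N" "j < N"
  shows "(\<Sum>l<N. \<Sum>m<N. z l m * ((if l = i then 1 else 0) - proj i l) * ((if m = j then 1 else 0) - proj j m))
    = z i j - (\<Sum>l<N. proj i l * z l j) - (\<Sum>l<N. proj j l * z l i)
        + (\<Sum>l<N. \<Sum>m<N. proj i l * proj j m * z l m)"
proof -
  have "(\<Sum>l<N. \<Sum>m<N. z l m * ((if l = i then 1 else 0) - proj i l) * ((if m = j then 1 else 0) - proj j m))
    = (\<Sum>l<N. \<Sum>m<N. (if m = j then (if l = i then z i j else 0) else 0)
        - (if m = j then proj i l * z l j else 0)
        - (if l = i then proj j m * z m i else 0) + proj i l * proj j m * z l m)"
    using assms by (intro sum.cong refl) (auto simp: algebra_simps z_sym)
  also have "\<dots> = z i j - (\<Sum>l<N. proj i l * z l j)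
        - (\<Sum>l<N. \<Sum>m<N. if l = i then proj j m * z m i else 0)
        + (\<Sum>l<N. \<Sum>m<N. proj i l * proj j m * z l m)"
    using assms by (simp add: sum.distrib sum_subtractf)
  also have "(\<Sum>l<N. \<Sum>m<N. if l = i then proj j m * z m i else 0) = (\<Sum>l<N. proj j l * z l i)"
    using assms by (subst sum.swap) simp
  finally show ?thesis .
qed

text \<open>Positivity of \<open>Z\<close> on the vector \<open>(I - P) (e\<^sub>i - e\<^sub>j)\<close>.\<close>
lemma pair_bound:
  assumes i: "i < N" and j: "j < N"
  shows "- 2 * (proj i i * outside i + proj j j * outside j
            + (\<Sum>l<N. proj i l * z l j) + (\<Sum>l<N. proj j l * z l i))
      \<le> z i i + z j j - 2 * z i j - proj i i - proj j j"
proof -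
  \<comment> \<open>\<open>u i\<close> is a row of I - P, while \<open>r\<close> and
    \<open>t\<close> hold the entries of P Z and P Z P.\<close>
  define u where "u i l = (if l = i then 1 else 0) - proj i l" for i l
  define r where "r i j = (\<Sum>l<N. proj i l * z l j)" for i j
  define t where "t i j = (\<Sum>l<N. \<Sum>m<N. proj i l * proj j m * z l m)" for i j
  have B: "(\<Sum>l<N. \<Sum>m<N. z l m * u i l * u j m) = z i j - r i j - r j i + t i j"
    if "i < N" "j < N" for i j
    using bilinear_unit_minus_proj[OF that] by (simp only: u_def r_def t_def)
  have t_sym: "t j i = t i j"
    unfolding t_def by (subst sum.swap) (intro sum.cong refl, simp add: z_sym mult_ac)
  have "0 \<le> qform N z (\<lambda>l. u i l - u j l)" by (rule psd_qform_nonneg[OF Z_psd Z_carrier])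
  also have "\<dots> = (\<Sum>l<N. \<Sum>m<N. z l m * u i l * u i m) - (\<Sum>l<N. \<Sum>m<N. z l m * u i l * u j m)
      - (\<Sum>l<N. \<Sum>m<N. z l m * u j l * u i m) + (\<Sum>l<N. \<Sum>m<N. z l m * u j l * u j m)"
    unfolding qform_def sum_subtractf[symmetric] sum.distrib[symmetric]
    by (intro sum.cong refl) (simp add: algebra_simps)
  finally have *: "0 \<le> (z i i - 2 * r i i + t i i) + (z j j - 2 * r j j + t j j)
      - 2 * (z i j - r i j - r j i + t i j)"
    using z_sym[OF i j] B[OF i i] B[OF i j] B[OF j i] B[OF j j] t_sym by (simp add: algebra_simps)
  have r_diag: "r i i = proj i i * (1 - outside i)" if "i < N" for i
    unfolding r_def sum_proj_z[OF that, symmetric] using that by (intro sum.cong refl) (simp add: z_sym)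
  \<comment> \<open>One weight is replaced by its row maximum \<open>proj i i\<close>; the row sums
    of \<open>Z\<close> and of P, both 1, then collapse the double sum.\<close>
  have t_diag: "t i i \<le> proj i i" if "i < N" for i
  proof -
    have "t i i \<le> (\<Sum>l<N. \<Sum>m<N. proj i l * proj i i * z l m)"
      unfolding t_def
      by (intro sum_mono mult_right_mono mult_left_mono proj_le_diag proj_nonneg z_nonneg) auto
    also have "\<dots> = (\<Sum>l<N. proj i l * proj i i)"
      by (intro sum.cong refl) (simp add: z_row flip: sum_distrib_left)
    also have "\<dots> = proj i i" using proj_row[OF that] by (simp flip: sum_distrib_right)
    finally show ?thesis .
  qed
  have "0 \<le> t i j"
    unfolding t_def by (intro sum_nonneg mult_nonneg_nonneg proj_nonneg z_nonneg) auto
  thus ?thesis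
    using * r_diag[OF i] r_diag[OF j] t_diag[OF i] t_diag[OF j]
    by (simp add: r_def algebra_simps)
qed

text \<open>Symmetrizing over both directions of an edge makes \<open>pair_bound\<close> applicable
  and bounds \<open>?S\<close> below by minus twice a sum of two error terms. Each term is at most
  \<open>\<delta> * defect\<close>, whence the constant 4.\<close>

lemma cut_bound:
  assumes w_nonneg: "\<And>i j. i < N \<Longrightarrow> j < N \<Longrightarrow> 0 \<le> w i j"
    and w_sym: "\<And>i j. i < N \<Longrightarrow> j < N \<Longrightarrow> w i j = w j i"
    and \<delta>: "\<And>i. i < N \<Longrightarrow> (\<Sum>j<N. cut_weight w i j) \<le> \<delta>"
  shows "- 4 * \<delta> * defect \<le> (\<Sum>i<N. \<Sum>j<N. cut_weight w i j * ((z i i - z i j) - (proj i i - proj i j)))"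
    (is "_ \<le> ?S")
proof -
  define x where "x = cut_weight w"
  define r where "r i j = (\<Sum>l<N. proj i l * z l j)" for i j
  have x_sym: "x i j = x j i" if "i < N" "j < N" for i j
    using w_sym[OF that] by (auto simp: x_def cut_weight_def)
  have x_nonneg: "0 \<le> x i j" if "i < N" "j < N" for i j
    using w_nonneg[OF that] by (simp add: x_def cut_weight_def)
  have "2 * ?S = ?S + (\<Sum>i<N. \<Sum>j<N. x i j * ((z j j - z j i) - (proj j j - proj j i)))"
    unfolding x_def[symmetric]
    using sum_weights_swap[OF x_sym, where f = "\<lambda>i j. (z i i - z i j) - (proj i i - proj i j)"] by simp
  \<comment> \<open>The entry \<open>proj i j\<close> has disappeared because it is zero across
    clusters, and \<open>x i j\<close> is zero within them.\<close>
  also have "\<dots> = (\<Sum>i<N. \<Sum>j<N. x i j * (z i i + z j j - 2 * z i j - proj i i - proj j j))"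
    unfolding x_def[symmetric] sum.distrib[symmetric]
    by (intro sum.cong refl) (auto simp: x_def cut_weight_def proj_def z_sym algebra_simps)
  also have "\<dots> \<ge> (\<Sum>i<N. \<Sum>j<N. x i j *
      (- 2 * (proj i i * outside i + proj j j * outside j + r i j + r j i)))"
    unfolding r_def by (intro sum_mono mult_left_mono pair_bound x_nonneg) auto
  also have "(\<Sum>i<N. \<Sum>j<N. x i j * (- 2 * (proj i i * outside i + proj j j * outside j + r i j + r j i)))
     = - 2 * ((\<Sum>i<N. \<Sum>j<N. x i j * (proj i i * outside i + r j i))
            + (\<Sum>i<N. \<Sum>j<N. x i j * (proj j j * outside j + r i j)))"
    by (simp add: sum_distrib_left sum.distrib[symmetric] algebra_simps)
  also have "(\<Sum>i<N. \<Sum>j<N. x i j * (proj j j * outside j + r i j))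
      = (\<Sum>i<N. \<Sum>j<N. x i j * (proj i i * outside i + r j i))"
    using sum_weights_swap[OF x_sym, where f = "\<lambda>i j. proj i i * outside i + r j i"] by simp
  finally have "- 2 * (\<Sum>i<N. \<Sum>j<N. x i j * (proj i i * outside i + r j i)) \<le> ?S" by simp
  moreover have "(\<Sum>i<N. \<Sum>j<N. x i j * (proj i i * outside i)) \<le> \<delta> * defect"
  proof -
    have "(\<Sum>i<N. \<Sum>j<N. x i j * (proj i i * outside i)) = (\<Sum>i<N. (\<Sum>j<N. x i j) * (proj i i * outside i))"
      by (simp add: sum_distrib_right)
    also have "\<dots> \<le> (\<Sum>i<N. \<delta> * (proj i i * outside i))"
      using \<delta> by (intro sum_mono mult_right_mono mult_nonneg_nonneg proj_nonneg outside_nonneg) (auto simp: x_def)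
    finally show ?thesis by (simp add: defect_def sum_distrib_left)
  qed
  \<comment> \<open>Expand \<open>r j i\<close> over \<open>l\<close>. If \<open>l\<close> lies in
    the cluster of \<open>i\<close>, then \<open>x i j\<close> or \<open>proj j l\<close> is zero.
    Otherwise \<open>proj j l\<close> is at most \<open>proj l l\<close>, the sum over
    \<open>j\<close> costs a factor \<delta>, and the remaining entries \<open>z l i\<close> add up
    to \<open>outside l\<close>.\<close>
  moreover have "(\<Sum>i<N. \<Sum>j<N. x i j * r j i) \<le> \<delta> * defect"
  proof -
    have "(\<Sum>i<N. \<Sum>j<N. x i j * r j i) = (\<Sum>i<N. \<Sum>l<N. (\<Sum>j<N. x i j * proj j l) * z l i)"
      by (simp add: r_def sum_distrib_left sum_distrib_right mult.assoc)
        (intro sum.cong refl sum.swap)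
    also have "\<dots> \<le> (\<Sum>i<N. \<Sum>l<N. \<delta> * (proj l l * (if c l = c i then 0 else z l i)))"
    proof (intro sum_mono)
      fix i l assume "i \<in> {..<N}" "l \<in> {..<N}"
      hence il: "i < N" "l < N" by auto
      show "(\<Sum>j<N. x i j * proj j l) * z l i \<le> \<delta> * (proj l l * (if c l = c i then 0 else z l i))"
      proof (cases "c l = c i")
        case True
        have "(\<Sum>j<N. x i j * proj j l) = 0"
          using True by (intro sum.neutral) (auto simp: x_def cut_weight_def proj_def)
        thus ?thesis using True by simp
      next
        case False
        have "(\<Sum>j<N. x i j * proj j l) \<le> (\<Sum>j<N. x i j * proj l l)"
          using il by (intro sum_mono mult_left_mono x_nonneg) (auto simp: proj_le_diag')
        also have "\<dots> \<le> \<delta> * proj l l"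
          using \<delta>[OF il(1)] by (simp add: x_def mult_right_mono proj_nonneg flip: sum_distrib_right)
        finally have "(\<Sum>j<N. x i j * proj j l) * z l i \<le> \<delta> * proj l l * z l i"
          using il by (intro mult_right_mono z_nonneg)
        thus ?thesis using False by (simp add: mult.assoc)
      qed
    qed
    also have "\<dots> = \<delta> * defect"
      unfolding defect_def outside_def sum_distrib_left by (rule sum.swap)
    finally show ?thesis .
  qed
  ultimately show ?thesis by (simp add: distrib_left sum.distrib)
qed

text \<open>Zero defect removes all entries across clusters. It also forces the form of
  \<open>Z\<close> to vanish on differences of unit vectors within a cluster; these lie in the
  kernel, so rows of \<open>Z\<close> are constant on clusters, and row sum 1 fixes the
  constant.\<close>

lemma defect_zero_imp_proj:
  assumes "defect = 0" "i < N" "j < N"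
  shows "z i j = proj i j"
proof -
  have off: "z i j = 0" if "i < N" "j < N" "c i \<noteq> c j" for i j
  proof -
    have "\<forall>i\<in>{..<N}. proj i i * outside i = 0"
      using assms(1) unfolding defect_def
      by (subst (asm) sum_nonneg_eq_0_iff) (auto intro!: mult_nonneg_nonneg proj_nonneg outside_nonneg)
    hence "outside i = 0" using that(1) csize_pos[of i] by (force simp: proj_def)
    hence "\<forall>j\<in>{..<N}. (if c i = c j then 0 else z i j) = 0"
      unfolding outside_def using that(1) by (subst (asm) sum_nonneg_eq_0_iff) (auto intro: z_nonneg)
    from bspec[OF this, of j] show ?thesis using that by simp
  qed
  define f where "f i j = proj i j * (z i i + z j j - 2 * z i j)" for i j
  have unit_diff: "qform N z (\<lambda>l. (if l = i then 1 else 0) - (if l = j then 1 else 0)) = z i i + z j j - 2 * z i j"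
    if "i < N" "j < N" for i j
  proof -
    have "qform N z (\<lambda>l. (if l = i then 1 else 0) - (if l = j then 1 else 0)) =
      (\<Sum>l<N. \<Sum>m<N. (if m = i then (if l = i then z i i else 0) else 0)
       - (if m = i then (if l = j then z i j else 0) else 0)
       - (if m = j then (if l = i then z i j else 0) else 0)
       + (if m = j then (if l = j then z j j else 0) else 0))"
      unfolding qform_def using that
      by (intro sum.cong refl) (auto simp: z_sym)
    thus ?thesis using that by (simp add: sum.distrib sum_subtractf)
  qed
  have f_nonneg: "0 \<le> f i j" if "i < N" "j < N" for i j
    unfolding f_def unit_diff[OF that, symmetric]
    by (intro mult_nonneg_nonneg proj_nonneg psd_qform_nonneg[OF Z_psd Z_carrier])
  \<comment> \<open>Since P has row sums 1, this total equals \<open>2 * defect\<close>.\<close>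
  have "(\<Sum>i<N. \<Sum>j<N. f i j) = (\<Sum>i<N. \<Sum>j<N. proj i j * z i i) + (\<Sum>i<N. \<Sum>j<N. proj i j * z j j)
      - 2 * (\<Sum>i<N. \<Sum>j<N. proj i j * z i j)"
    by (simp add: f_def algebra_simps sum.distrib sum_subtractf sum_distrib_left)
  also have "(\<Sum>i<N. \<Sum>j<N. proj i j * z j j) = (\<Sum>i<N. \<Sum>j<N. proj i j * z i i)"
    using sum_weights_swap[of N proj, where f = "\<lambda>i j. z i i"] by (simp add: proj_sym)
  also have "(\<Sum>i<N. \<Sum>j<N. proj i j * z i i) = (\<Sum>i<N. z i i)"
    by (intro sum.cong refl) (simp add: proj_row flip: sum_distrib_right)
  finally have "(\<Sum>i<N. \<Sum>j<N. f i j) = 0" using assms(1) defect_eq by simp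
  hence f_rows: "\<forall>i\<in>{..<N}. (\<Sum>j<N. f i j) = 0"
    by (subst (asm) sum_nonneg_eq_0_iff) (auto intro!: sum_nonneg f_nonneg)
  have f_zero: "f i j = 0" if "i < N" "j < N" for i j
  proof -
    have "(\<Sum>j<N. f i j) = 0" using f_rows that by simp
    hence "\<forall>j\<in>{..<N}. f i j = 0"
      using that(1) by (subst (asm) sum_nonneg_eq_0_iff) (auto intro: f_nonneg)
    thus ?thesis using that by simp
  qed
  have const: "z l i = z l j" if "i < N" "j < N" "l < N" "c i = c j" for i j l
  proof -
    have "z i i + z j j - 2 * z i j = 0"
      using f_zero[OF that(1,2)] csize_pos[OF that(1)] that(4) by (auto simp: f_def proj_def)
    hence "(\<Sum>m<N. z l m * ((if m = i then 1 else 0) - (if m = j then 1 else 0))) = 0"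
      by (intro psd_qform_zero_imp_kernel[OF Z_psd Z_carrier _ that(3)]) (simp add: unit_diff that)
    moreover have "(\<Sum>m<N. z l m * ((if m = i then 1 else 0) - (if m = j then 1 else 0)))
        = (\<Sum>m<N. (if m = i then z l i else 0) - (if m = j then z l j else 0))"
      by (intro sum.cong refl) auto
    ultimately show ?thesis using that by (simp add: sum_subtractf)
  qed
  show ?thesis
  proof (cases "c i = c j")
    case True
    have "1 = (\<Sum>l<N. z i l)" using assms by (simp add: z_row)
    also have "\<dots> = (\<Sum>l<N. if c i = c l then z i j else 0)"
      using assms True by (intro sum.cong refl) (auto simp: off intro!: const)
    also have "\<dots> = csize i * z i j" by (rule sum_same_cluster)
    finally show ?thesis using True csize_pos[OF assms(2)] by (simp add: proj_def field_simps)
  next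
    case False
    thus ?thesis using off assms by (simp add: proj_def)
  qed
qed

text \<open>The matrix \<open>M\<close> has a nonnegative form by \<open>gap\<close>, and pairing it
  with \<open>Z\<close> bounds the inner edges below by \<open>\<mu> * defect\<close>. The cut edges
  are controlled by \<open>cut_bound\<close>.\<close>

lemma objective_gap:
  assumes w_nonneg: "\<And>i j. i < N \<Longrightarrow> j < N \<Longrightarrow> 0 \<le> w i j"
    and w_sym: "\<And>i j. i < N \<Longrightarrow> j < N \<Longrightarrow> w i j = w j i"
    and \<delta>: "\<And>i. i < N \<Longrightarrow> (\<Sum>j<N. cut_weight w i j) \<le> \<delta>"
    and gap: "\<And>v. \<mu> * ((\<Sum>l<N. (v l)\<^sup>2) - qform N proj v) \<le> qform N (lap N (inner_weight w)) v"
  shows "(\<mu> - 4 * \<delta>) * defect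
    \<le> (\<Sum>i<N. \<Sum>j<N. lap N w i j * z i j) - (\<Sum>i<N. \<Sum>j<N. lap N w i j * proj i j)"
proof -
  define M where "M i j = lap N (inner_weight w) i j - \<mu> * ((if j = i then 1 else 0) - proj i j)" for i j
  have "qform N M v = qform N (lap N (inner_weight w)) v - \<mu> * ((\<Sum>l<N. (v l)\<^sup>2) - qform N proj v)" for v
  proof -
    have "qform N M v = (\<Sum>i<N. \<Sum>j<N. lap N (inner_weight w) i j * v i * v j
        - (if j = i then \<mu> * (v i)\<^sup>2 else 0) + \<mu> * (proj i j * v i * v j))"
      unfolding qform_def M_def by (intro sum.cong refl) (auto simp: algebra_simps power2_eq_square)
    also have "\<dots> = qform N (lap N (inner_weight w)) v - \<mu> * (\<Sum>l<N. (v l)\<^sup>2) + \<mu> * qform N proj v"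
      by (simp add: qform_def sum.distrib sum_subtractf sum_distrib_left)
    finally show ?thesis by (simp add: algebra_simps)
  qed
  hence "0 \<le> (\<Sum>i<N. \<Sum>j<N. M i j * z i j)"
    using gap by (intro psd_inner_nonneg[OF Z_psd Z_carrier]) simp
  also have "\<dots> = (\<Sum>i<N. \<Sum>j<N. lap N (inner_weight w) i j * z i j
      - (if j = i then \<mu> * z i i else 0) + \<mu> * (proj i j * z i j))"
    unfolding M_def by (intro sum.cong refl) (auto simp: algebra_simps)
  also have "\<dots> = (\<Sum>i<N. \<Sum>j<N. lap N (inner_weight w) i j * z i j) - \<mu> * defect"
    by (simp add: defect_eq sum.distrib sum_subtractf right_diff_distrib flip: sum_distrib_left)
  finally have inner: "\<mu> * defect \<le> (\<Sum>i<N. \<Sum>j<N. inner_weight w i j * (z i i - z i j))"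
    by (simp add: lap_inner)
  \<comment> \<open>On inner edges \<open>proj i i\<close> equals \<open>proj i j\<close>, so the
    value at P enters through cut edges only.\<close>
  have "(\<Sum>i<N. \<Sum>j<N. lap N w i j * z i j) - (\<Sum>i<N. \<Sum>j<N. lap N w i j * proj i j)
      = (\<Sum>i<N. \<Sum>j<N. inner_weight w i j * (z i i - z i j))
        + (\<Sum>i<N. \<Sum>j<N. cut_weight w i j * ((z i i - z i j) - (proj i i - proj i j)))"
    unfolding lap_inner sum_subtractf[symmetric] sum.distrib[symmetric]
    by (intro sum.cong refl) (auto simp: inner_weight_def cut_weight_def proj_def algebra_simps)
  thus ?thesis using inner cut_bound[OF w_nonneg w_sym \<delta>] by (simp add: algebra_simps)
qed

end

section \<open>Eigenvalues of the block-diagonal Laplacian\<close>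

context clustering begin

definition cluster :: "nat \<Rightarrow> nat set" where
  "cluster a = {i. i < N \<and> c i = a}"

lemma finite_cluster: "finite (cluster a)"
  by (simp add: cluster_def)

lemma sum_clusters:
  fixes f :: "nat \<Rightarrow> real"
  shows "(\<Sum>a\<in>{1..k}. \<Sum>i\<in>cluster a. f i) = (\<Sum>i<N. f i)"
proof -
  have "(\<Sum>a\<in>{1..k}. \<Sum>i\<in>{i\<in>{..<N}. c i = a}. f i) = (\<Sum>i<N. f i)"
    using c_range by (intro sum.group) auto
  thus ?thesis by (simp add: cluster_def)
qed

lemma sum_cluster_eq:
  fixes f :: "nat \<Rightarrow> real"
  assumes "\<And>j. j < N \<Longrightarrow> c j \<noteq> a \<Longrightarrow> f j = 0"
  shows "(\<Sum>j\<in>cluster a. f j) = (\<Sum>j<N. f j)"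
  using assms by (intro sum.mono_neutral_left) (auto simp: cluster_def)

definition qform_on :: "nat \<Rightarrow> (nat \<Rightarrow> nat \<Rightarrow> real) \<Rightarrow> (nat \<Rightarrow> real) \<Rightarrow> real" where
  "qform_on a M v = (\<Sum>i\<in>cluster a. \<Sum>j\<in>cluster a. M i j * v i * v j)"

lemma qform_split:
  assumes "\<And>i j. i < N \<Longrightarrow> j < N \<Longrightarrow> c i \<noteq> c j \<Longrightarrow> M i j = 0"
  shows "qform N M v = (\<Sum>a\<in>{1..k}. qform_on a M v)"
proof -
  have "qform_on a M v = (\<Sum>i\<in>cluster a. \<Sum>j<N. M i j * v i * v j)" for a
    unfolding qform_on_def using assms
    by (intro sum.cong refl sum_cluster_eq) (auto simp: cluster_def)
  thus ?thesis unfolding qform_def by (simp only: sum_clusters)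
qed

text \<open>The condition L_iso \<succeq> \<mu> (I - P) on one block, when \<open>M\<close> is
  L_iso. Vectors are functions on all vertices, but only their values on the cluster count.\<close>

definition gap_on :: "nat \<Rightarrow> (nat \<Rightarrow> nat \<Rightarrow> real) \<Rightarrow> real \<Rightarrow> (nat \<Rightarrow> real) \<Rightarrow> bool" where
  "gap_on a M \<mu> v \<longleftrightarrow> \<mu> * ((\<Sum>i\<in>cluster a. (v i)\<^sup>2) - qform_on a proj v) \<le> qform_on a M v"

text \<open>Both \<open>M\<close> and P are block diagonal: testing with \<open>v\<close> cut off to
  one cluster gives one direction, adding over the clusters the other.\<close>

lemma gap_iff_gap_on:
  assumes "\<And>i j. i < N \<Longrightarrow> j < N \<Longrightarrow> c i \<noteq> c j \<Longrightarrow> M i j = 0"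
  shows "(\<forall>v. \<mu> * ((\<Sum>l<N. (v l)\<^sup>2) - qform N proj v) \<le> qform N M v)
    \<longleftrightarrow> (\<forall>a\<in>{1..k}. \<forall>v. gap_on a M \<mu> v)"
proof -
  have proj_split: "qform N proj v = (\<Sum>a\<in>{1..k}. qform_on a proj v)" for v
    by (rule qform_split) (simp add: proj_def)
  note splits = proj_split qform_split[OF assms] sum_clusters[symmetric]
  show ?thesis
  proof (intro iffI ballI allI)
    fix a v assume *: "\<forall>v. \<mu> * ((\<Sum>l<N. (v l)\<^sup>2) - qform N proj v) \<le> qform N M v" and a: "a \<in> {1..k}"
    define u :: "nat \<Rightarrow> real" where "u i = (if c i = a then v i else 0)" for i
    have sq: "(\<Sum>l<N. (u l)\<^sup>2) = (\<Sum>i\<in>cluster a. (v i)\<^sup>2)"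
    proof -
      have "(\<Sum>l<N. (u l)\<^sup>2) = (\<Sum>i\<in>cluster a. (u i)\<^sup>2)"
        by (rule sum_cluster_eq[symmetric]) (simp add: u_def)
      thus ?thesis by (simp add: u_def cluster_def)
    qed
    have on: "qform N X u = qform_on a X v" for X
    proof -
      have "qform N X u = (\<Sum>i\<in>cluster a. \<Sum>j<N. X i j * u i * u j)"
        unfolding qform_def by (rule sum_cluster_eq[symmetric]) (simp add: u_def)
      also have "\<dots> = (\<Sum>i\<in>cluster a. \<Sum>j\<in>cluster a. X i j * u i * u j)"
        by (intro sum.cong refl sum_cluster_eq[symmetric]) (simp add: u_def)
      also have "\<dots> = qform_on a X v"
        unfolding qform_on_def by (intro sum.cong refl) (auto simp: u_def cluster_def)
      finally show ?thesis .
    qed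
    show "gap_on a M \<mu> v" using spec[OF *, of u] by (simp add: gap_on_def sq on)
  next
    fix v assume *: "\<forall>a\<in>{1..k}. \<forall>v. gap_on a M \<mu> v"
    have "\<mu> * ((\<Sum>l<N. (v l)\<^sup>2) - qform N proj v)
        = (\<Sum>a\<in>{1..k}. \<mu> * ((\<Sum>i\<in>cluster a. (v i)\<^sup>2) - qform_on a proj v))"
      unfolding proj_split sum_clusters[symmetric] by (simp add: sum_subtractf flip: sum_distrib_left)
    also have "\<dots> \<le> (\<Sum>a\<in>{1..k}. qform_on a M v)"
      using * by (intro sum_mono) (simp add: gap_on_def)
    also have "\<dots> = qform N M v" by (rule qform_split[OF assms, symmetric])
    finally show "\<mu> * ((\<Sum>l<N. (v l)\<^sup>2) - qform N proj v) \<le> qform N M v" .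
  qed
qed

text \<open>\<open>submatrix\<close> numbers its rows and columns through \<open>pick\<close>, so
  this bijection carries sums over a block to sums over its cluster.\<close>

lemma pick_cluster:
  "bij_betw (pick (cluster a)) {..<card (cluster a)} (cluster a)"
proof (rule bij_betw_imageI)
  show inj: "inj_on (pick (cluster a)) {..<card (cluster a)}"
    by (rule linorder_inj_onI') (use pick_mono_le[of _ "cluster a"] in force)
  have "pick (cluster a) ` {..<card (cluster a)} \<subseteq> cluster a"
    using pick_in_set_le[of _ "cluster a"] by auto
  thus "pick (cluster a) ` {..<card (cluster a)} = cluster a"
    by (intro card_subset_eq finite_cluster) (simp_all add: card_image[OF inj])
qed

lemma sum_pick:
  fixes f :: "nat \<Rightarrow> real"
  shows "(\<Sum>i<card (cluster a). f (pick (cluster a) i)) = (\<Sum>i\<in>cluster a. f i)"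
  by (rule sum.reindex_bij_betw[OF pick_cluster])

lemma pick_in_cluster: "i < card (cluster a) \<Longrightarrow> pick (cluster a) i \<in> cluster a"
  by (rule pick_in_set_le)

text \<open>An instance of \<open>le_eigval_iff\<close> with kernel part of dimension 1, as P
  restricted to a block has trace 1. For a single vertex I - P is zero on the block and every \<mu>
  is admissible, in accordance with the value \<open>\<infinity>\<close>.\<close>

lemma le_eigval2_iff:
  assumes w_nonneg: "\<And>i j. i < N \<Longrightarrow> j < N \<Longrightarrow> 0 \<le> w i j"
    and w_sym: "\<And>i j. i < N \<Longrightarrow> j < N \<Longrightarrow> w i j = w j i"
    and A: "A \<in> carrier_mat N N"
    and A_eq: "\<And>i j. i < N \<Longrightarrow> j < N \<Longrightarrow> A $$ (i, j) = lap N (inner_weight w) i j"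
    and a: "a \<in> {1..k}" and \<mu>: "0 \<le> \<mu>"
  shows "ereal \<mu> \<le> eigval2 (submatrix A (cluster a) (cluster a)) \<longleftrightarrow> (\<forall>v. gap_on a (entries A) \<mu> v)"
proof -
  define B where "B = submatrix A (cluster a) (cluster a)"
  define n where "n = card (cluster a)"
  define s where "s = pick (cluster a)"
  have s: "s i < N" "c (s i) = a" if "i < n" for i
    using pick_in_cluster[of i a] that by (auto simp: s_def n_def cluster_def)
  have card_eq: "card {i. i < N \<and> i \<in> cluster a} = n"
    unfolding n_def by (rule arg_cong[where f = card]) (auto simp: cluster_def)
  have B: "B \<in> carrier_mat n n"
    using A card_eq by (intro carrier_matI) (simp_all add: B_def dim_submatrix)
  have B_index: "B $$ (i, j) = A $$ (s i, s j)" if "i < n" "j < n" for i j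
    unfolding B_def s_def using A that card_eq by (intro submatrix_index) simp_all
  have iw_sym: "inner_weight w i j = inner_weight w j i" if "i < N" "j < N" for i j
    using w_sym[OF that] by (simp add: inner_weight_def)
  have A_sym: "A $$ (i, j) = A $$ (j, i)" if "i < N" "j < N" for i j
    using that iw_sym[OF that] by (simp add: A_eq lap_def)
  have A_off: "A $$ (i, j) = 0" if "i < N" "j < N" "c i \<noteq> c j" for i j
    using that by (auto simp: A_eq lap_def inner_weight_def)
  have A_nonneg: "0 \<le> qform N (entries A) v" for v
  proof -
    have "qform N (entries A) v = qform N (lap N (inner_weight w)) v"
      unfolding qform_def by (intro sum.cong refl) (simp add: A_eq)
    moreover have "0 \<le> qform N (lap N (inner_weight w)) v"
      using w_nonneg iw_sym by (intro lap_qform_nonneg) (simp_all add: inner_weight_def)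
    ultimately show ?thesis by simp
  qed
  have on_nonneg: "0 \<le> qform_on a (entries A) v" for v
    using gap_iff_gap_on[of "entries A" 0] A_off A_nonneg a by (auto simp: gap_on_def)
  have n_pos: "0 < n" using c_onto[OF a] by (auto simp: n_def card_gt_0_iff finite_cluster cluster_def)
  have pull: "qform n (\<lambda>i j. M (s i) (s j)) (\<lambda>i. v (s i)) = qform_on a M v" for M v
    unfolding qform_def qform_on_def n_def s_def
    by (subst sum_pick[symmetric], subst sum_pick[symmetric]) (rule refl)
  have qform_B: "qform n (entries B) (\<lambda>i. v (s i)) = qform_on a (entries A) v" for v
    unfolding pull[symmetric] qform_def by (intro sum.cong refl) (simp add: B_index)
  have B_sym: "transpose_mat B = B"
    using B by (intro eq_matI) (auto simp: B_index A_sym s)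
  \<comment> \<open>As \<open>s\<close> is injective, every vector on the block comes from a
    function on vertices.\<close>
  have lift: "\<exists>u. \<forall>i<n. v i = u (s i)" for v :: "nat \<Rightarrow> real"
  proof (intro exI allI impI)
    fix i assume "i < n"
    thus "v i = (v \<circ> inv_into {..<n} s) (s i)"
      using bij_betw_imp_inj_on[OF pick_cluster, of a] by (simp add: s_def n_def)
  qed
  have cong: "qform n M v = qform n M u" if "\<forall>i<n. v i = u i" for M u v
    unfolding qform_def using that by (intro sum.cong refl) simp
  show ?thesis
  proof (cases "n = 1")
    case True
    then obtain i where i: "cluster a = {i}" by (auto simp: n_def card_1_singleton_iff)
    hence "i \<in> cluster a" by simp
    hence "i < N" "c i = a" by (auto simp: cluster_def)
    have "{j\<in>{..<N}. c j = c i} = {i}" using i \<open>c i = a\<close> by (auto simp: cluster_def)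
    hence "proj i i = 1" by (simp add: proj_def csize_def)
    hence "gap_on a (entries A) \<mu> v" for v
      using on_nonneg[of v] by (simp add: gap_on_def i qform_on_def power2_eq_square)
    moreover have "eigval2 B = \<infinity>" using B True by (simp add: eigval2_def)
    ultimately show ?thesis by (simp add: B_def)
  next
    case False
    define P where "P i j = proj (s i) (s j)" for i j
    have sum_P: "(\<Sum>r<n. f (s r)) = (\<Sum>r\<in>cluster a. f r)" for f :: "nat \<Rightarrow> real"
      unfolding n_def s_def by (rule sum_pick)
    have "\<mu> \<le> eigval (1 + 1) B \<longleftrightarrow>
        (\<forall>v. \<mu> * ((\<Sum>l<n. (v l)\<^sup>2) - qform n P v) \<le> qform n (entries B) v)"
    proof (rule le_eigval_iff[OF B B_sym _ _ _ _ _ _ \<mu>])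
      fix v :: "nat \<Rightarrow> real"
      obtain u where u: "\<forall>i<n. v i = u (s i)" using lift[of v] by blast
      show "0 \<le> qform n (entries B) v"
        unfolding cong[OF u] qform_B by (rule on_nonneg)
    next
      show "P l m = P m l" for l m by (simp add: P_def proj_sym)
    next
      fix l m assume lm: "l < n" "m < n"
      have "(\<Sum>r<n. P l r * P r m) = (\<Sum>r\<in>cluster a. proj (s l) r * proj r (s m))"
        unfolding P_def by (rule sum_P)
      also have "\<dots> = (\<Sum>r<N. proj (s l) r * proj r (s m))"
        by (rule sum_cluster_eq) (use s lm in \<open>auto simp: proj_def\<close>)
      also have "\<dots> = P l m" unfolding P_def by (rule proj_idem) (use s lm in auto)
      finally show "(\<Sum>r<n. P l r * P r m) = P l m" .
    next
      obtain i where i: "i < N" "c i = a" using c_onto[OF a] by blast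
      have "(\<Sum>l<n. P l l) = (\<Sum>l\<in>cluster a. proj l l)" unfolding P_def by (rule sum_P)
      also have "\<dots> = (\<Sum>l\<in>cluster a. proj i l)"
        by (intro sum.cong refl) (auto simp: cluster_def proj_def csize_def i)
      also have "\<dots> = (\<Sum>l<N. proj i l)"
        by (rule sum_cluster_eq) (use i in \<open>auto simp: proj_def\<close>)
      finally show "(\<Sum>l<n. P l l) = real 1" by (simp add: proj_row i)
    next
      show "1 < n" using n_pos False by simp
    next
      fix l m assume lm: "l < n" "m < n"
      have "(\<Sum>r<n. B $$ (l, r) * P r m) = (\<Sum>r<n. A $$ (s l, s r) * proj (s r) (s m))"
        using lm by (intro sum.cong refl) (simp add: P_def B_index)
      also have "\<dots> = (\<Sum>r\<in>cluster a. A $$ (s l, r) * proj r (s m))" by (rule sum_P)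
      also have "\<dots> = (\<Sum>r<N. A $$ (s l, r) * proj r (s m))"
        by (rule sum_cluster_eq) (use s lm in \<open>auto simp: proj_def\<close>)
      also have "\<dots> = (\<Sum>r<N. lap N (inner_weight w) (s l) r * proj r (s m))"
        using s lm by (intro sum.cong refl) (simp add: A_eq)
      also have "\<dots> = 0" by (rule lap_inner_weight_proj) (use s lm in auto)
      finally show "(\<Sum>r<n. B $$ (l, r) * P r m) = 0" .
    qed
    also have "\<dots> \<longleftrightarrow> (\<forall>v. gap_on a (entries A) \<mu> v)"
    proof -
      have gap_pull: "gap_on a (entries A) \<mu> u \<longleftrightarrow>
          \<mu> * ((\<Sum>l<n. (u (s l))\<^sup>2) - qform n P (\<lambda>i. u (s i))) \<le> qform n (entries B) (\<lambda>i. u (s i))" for u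
        unfolding gap_on_def qform_B P_def pull using sum_P[of "\<lambda>i. (u i)\<^sup>2"] by simp
      show ?thesis
      proof (intro iffI allI)
        fix v :: "nat \<Rightarrow> real" assume *: "\<forall>v. gap_on a (entries A) \<mu> v"
        obtain u where u: "\<forall>i<n. v i = u (s i)" using lift[of v] by blast
        have "(\<Sum>l<n. (v l)\<^sup>2) = (\<Sum>l<n. (u (s l))\<^sup>2)" using u by simp
        thus "\<mu> * ((\<Sum>l<n. (v l)\<^sup>2) - qform n P v) \<le> qform n (entries B) v"
          using spec[OF *, of u] unfolding gap_pull cong[OF u] by simp
      qed (simp add: gap_pull)
    qed
    finally show ?thesis using B False by (simp add: eigval2_def B_def[symmetric] numeral_2_eq_2)
  qed
qed

text \<open>Both sides of the first claim have the same nonnegative lower bounds \<mu>, by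
  \<open>le_eigval_iff\<close> for the whole matrix and \<open>le_eigval2_iff\<close> for the
  blocks. The last claim is the case in which \<mu> is the eigenvalue itself.\<close>

lemma eigval_inner_laplacian:
  assumes w_nonneg: "\<And>i j. i < N \<Longrightarrow> j < N \<Longrightarrow> 0 \<le> w i j"
    and w_sym: "\<And>i j. i < N \<Longrightarrow> j < N \<Longrightarrow> w i j = w j i"
    and A: "A \<in> carrier_mat N N"
    and A_eq: "\<And>i j. i < N \<Longrightarrow> j < N \<Longrightarrow> A $$ (i, j) = lap N (inner_weight w) i j"
    and k: "k < N"
  shows "ereal (eigval (k + 1) A) = Min ((\<lambda>a. eigval2 (submatrix A (cluster a) (cluster a))) ` {1..k})"
    and "0 \<le> eigval (k + 1) A"
    and "eigval (k + 1) A * ((\<Sum>l<N. (v l)\<^sup>2) - qform N proj v) \<le> qform N (lap N (inner_weight w)) v"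
proof -
  have iw_sym: "inner_weight w i j = inner_weight w j i" if "i < N" "j < N" for i j
    using w_sym[OF that] by (simp add: inner_weight_def)
  have A_sym: "transpose_mat A = A"
    using A iw_sym by (intro eq_matI) (auto simp: A_eq lap_def)
  have qform_A: "qform N (entries A) v = qform N (lap N (inner_weight w)) v" for v
    unfolding qform_def by (intro sum.cong refl) (simp add: A_eq)
  have A_nonneg: "0 \<le> qform N (entries A) v" for v
    unfolding qform_A using w_nonneg iw_sym by (intro lap_qform_nonneg) (auto simp: inner_weight_def)
  have AP: "(\<Sum>r<N. A $$ (l, r) * proj r m) = 0" if "l < N" for l m
  proof -
    have "(\<Sum>r<N. A $$ (l, r) * proj r m) = (\<Sum>r<N. lap N (inner_weight w) l r * proj r m)"
      using that by (intro sum.cong refl) (simp add: A_eq)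
    thus ?thesis by (simp add: lap_inner_weight_proj that)
  qed
  have iff: "\<mu> \<le> eigval (k + 1) A \<longleftrightarrow>
      (\<forall>v. \<mu> * ((\<Sum>l<N. (v l)\<^sup>2) - qform N proj v) \<le> qform N (entries A) v)" if "0 \<le> \<mu>" for \<mu>
    by (rule le_eigval_iff[OF A A_sym A_nonneg proj_sym proj_idem proj_trace k AP that])
  show nonneg: "0 \<le> eigval (k + 1) A" using iff[of 0] A_nonneg by simp
  show "eigval (k + 1) A * ((\<Sum>l<N. (v l)\<^sup>2) - qform N proj v) \<le> qform N (lap N (inner_weight w)) v"
    using iff[OF nonneg] by (simp add: qform_A)
  define y where "y a = eigval2 (submatrix A (cluster a) (cluster a))" for a
  have A_off: "A $$ (i, j) = 0" if "i < N" "j < N" "c i \<noteq> c j" for i j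
    using that by (auto simp: A_eq lap_def inner_weight_def)
  have iff2: "\<mu> \<le> eigval (k + 1) A \<longleftrightarrow> (\<forall>a\<in>{1..k}. ereal \<mu> \<le> y a)" if "0 \<le> \<mu>" for \<mu>
  proof -
    have "(\<forall>v. \<mu> * ((\<Sum>l<N. (v l)\<^sup>2) - qform N proj v) \<le> qform N (entries A) v)
        \<longleftrightarrow> (\<forall>a\<in>{1..k}. \<forall>v. gap_on a (entries A) \<mu> v)"
      by (rule gap_iff_gap_on) (rule A_off)
    thus ?thesis
      unfolding iff[OF that] y_def using le_eigval2_iff[OF w_nonneg w_sym A A_eq _ that] by simp
  qed
  \<comment> \<open>\<open>k < N\<close> provides vertex 0, whose label witnesses that the minimum
    is over a nonempty set.\<close>
  have ne: "{1..k} \<noteq> {}" using c_range[of 0] k by auto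
  have "ereal (eigval (k + 1) A) = Min (y ` {1..k})"
  proof (rule antisym)
    show "ereal (eigval (k + 1) A) \<le> Min (y ` {1..k})"
      using iff2[OF nonneg] ne by simp
    show "Min (y ` {1..k}) \<le> ereal (eigval (k + 1) A)"
    proof (rule ccontr)
      assume "\<not> Min (y ` {1..k}) \<le> ereal (eigval (k + 1) A)"
      \<comment> \<open>A real number strictly between exists even next to infinite values, and it
        is nonnegative because the eigenvalue is.\<close>
      then obtain \<mu> where \<mu>: "ereal (eigval (k + 1) A) < ereal \<mu>" "ereal \<mu> < Min (y ` {1..k})"
        using ereal_dense2[of "ereal (eigval (k + 1) A)" "Min (y ` {1..k})"] by (auto simp: not_le)
      hence "\<forall>a\<in>{1..k}. ereal \<mu> \<le> y a" using ne by (simp add: less_imp_le)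
      thus False using iff2[of \<mu>] nonneg \<mu>(1) by simp
    qed
  qed
  thus "ereal (eigval (k + 1) A) = Min ((\<lambda>a. eigval2 (submatrix A (cluster a) (cluster a))) ` {1..k})"
    by (simp add: y_def)
qed

end

section \<open>The ratio cut relaxation\<close>

lemma mat_inner_sum:
  assumes "A \<in> carrier_mat n n" "B \<in> carrier_mat n n"
  shows "mat_inner A B = (\<Sum>i<n. \<Sum>j<n. A $$ (i, j) * B $$ (i, j))"
proof -
  have At: "transpose_mat A \<in> carrier_mat n n" using assms by simp
  have "mat_inner A B = (\<Sum>j<n. (transpose_mat A * B) $$ (j, j))"
    using assms by (simp add: mat_inner_def trace_mat_def)
  also have "\<dots> = (\<Sum>j<n. \<Sum>i<n. A $$ (i, j) * B $$ (i, j))"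
    using assms by (intro sum.cong refl) (simp add: mat_mult_index_sum[OF At assms(2)] del: index_mult_mat)
  also have "\<dots> = (\<Sum>i<n. \<Sum>j<n. A $$ (i, j) * B $$ (i, j))" by (rule sum.swap)
  finally show ?thesis .
qed

lemma deg_mat_carrier: "W \<in> carrier_mat n n \<Longrightarrow> deg_mat W \<in> carrier_mat n n"
  by (auto simp: deg_mat_def mat_diag_def)

lemma laplacian_carrier: "W \<in> carrier_mat n n \<Longrightarrow> laplacian W \<in> carrier_mat n n"
  by (auto simp: laplacian_def deg_mat_def mat_diag_def)

lemma deg_mat_index:
  assumes "W \<in> carrier_mat n n" "i < n" "j < n"
  shows "deg_mat W $$ (i, j) = (if i = j then \<Sum>l<n. W $$ (i, l) else 0)"
proof -
  have "(W *\<^sub>v ones_vec n) $ i = (\<Sum>l<n. W $$ (i, l))"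
    using mat_vec_index_sum[OF assms(1) _ assms(2), of "ones_vec n"] by (simp add: ones_vec_def)
  thus ?thesis using assms by (auto simp: deg_mat_def mat_diag_def)
qed

lemma laplacian_index:
  assumes "W \<in> carrier_mat n n" "i < n" "j < n"
  shows "laplacian W $$ (i, j) = lap n (entries W) i j"
  using assms deg_mat_carrier[OF assms(1)] by (simp add: laplacian_def lap_def deg_mat_index)

lemma l2_norm_eq: "v \<in> carrier_vec n \<Longrightarrow> l2_norm v = sqrt (\<Sum>i<n. (v $ i)\<^sup>2)"
  by (simp add: l2_norm_def scalar_prod_def power2_eq_square atLeast0LessThan)

text \<open>The unit vector at \<open>i\<close> is mapped to a vector of norm
  \<open>\<bar>D $$ (i, i)\<bar>\<close>; the supremum dominates this value once the set is known to
  be bounded.\<close>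

lemma abs_diag_le_op_norm:
  assumes D: "D \<in> carrier_mat n n" and diag: "diagonal_mat D" and i: "i < n"
  shows "\<bar>D $$ (i, i)\<bar> \<le> op_norm D"
proof -
  have Dv: "(D *\<^sub>v v) $ j = D $$ (j, j) * v $ j" if "v \<in> carrier_vec n" "j < n" for v j
  proof -
    have "(D *\<^sub>v v) $ j = (\<Sum>l<n. D $$ (j, l) * v $ l)"
      by (rule mat_vec_index_sum[OF D that])
    also have "\<dots> = (\<Sum>l<n. if l = j then D $$ (j, j) * v $ j else 0)"
      using D diag that by (intro sum.cong refl) (auto simp: diagonal_mat_def)
    finally show ?thesis using that by simp
  qed
  have Dv_carrier: "D *\<^sub>v v \<in> carrier_vec n" for v
    by (rule carrier_vecI) (use D in simp)
  have norm: "l2_norm (D *\<^sub>v v) = sqrt (\<Sum>j<n. (D $$ (j, j) * v $ j)\<^sup>2)" if "v \<in> carrier_vec n" for v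
    unfolding l2_norm_eq[OF Dv_carrier]
    by (intro arg_cong[where f = sqrt] sum.cong refl) (simp only: Dv[OF that] lessThan_iff)
  \<comment> \<open>A crude bound suffices, since it only has to show that the supremum is over a
    set bounded above.\<close>
  define m where "m = (\<Sum>j<n. \<bar>D $$ (j, j)\<bar>)"
  have bound: "l2_norm (D *\<^sub>v v) \<le> m" if v: "v \<in> carrier_vec n" "l2_norm v \<le> 1" for v
  proof -
    have "(D $$ (j, j) * v $ j)\<^sup>2 \<le> m\<^sup>2 * (v $ j)\<^sup>2" if "j < n" for j
    proof -
      have "\<bar>D $$ (j, j)\<bar> \<le> m" unfolding m_def using that by (intro member_le_sum) auto
      hence "(D $$ (j, j))\<^sup>2 \<le> m\<^sup>2" using power_mono[of "\<bar>D $$ (j, j)\<bar>" m 2] by simp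
      thus ?thesis by (simp add: power_mult_distrib mult_right_mono)
    qed
    hence "(\<Sum>j<n. (D $$ (j, j) * v $ j)\<^sup>2) \<le> m\<^sup>2 * (\<Sum>j<n. (v $ j)\<^sup>2)"
      unfolding sum_distrib_left by (intro sum_mono) simp
    also have "\<dots> \<le> m\<^sup>2 * 1"
      using v by (intro mult_left_mono) (simp_all add: l2_norm_eq)
    finally have "sqrt (\<Sum>j<n. (D $$ (j, j) * v $ j)\<^sup>2) \<le> sqrt (m\<^sup>2)"
      by (intro real_sqrt_le_mono) simp
    also have "\<dots> = m" by (simp add: m_def sum_nonneg)
    finally show ?thesis using norm[OF v(1)] by simp
  qed
  have "l2_norm (D *\<^sub>v unit_vec n i) = sqrt (\<Sum>j<n. if j = i then (D $$ (i, i))\<^sup>2 else 0)"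
    unfolding norm[OF unit_vec_carrier] using i
    by (intro arg_cong[where f = sqrt] sum.cong refl) auto
  hence unit: "l2_norm (D *\<^sub>v unit_vec n i) = \<bar>D $$ (i, i)\<bar>" using i by simp
  have "l2_norm (unit_vec n i) = sqrt (\<Sum>j<n. if j = i then 1 else 0)"
    unfolding l2_norm_eq[OF unit_vec_carrier] using i
    by (intro arg_cong[where f = sqrt] sum.cong refl) auto
  hence "l2_norm (unit_vec n i) = 1" using i by simp
  thus ?thesis
    unfolding op_norm_def unit[symmetric] using D bound
    by (intro cSUP_upper bdd_aboveI2[of _ _ m]) auto
qed

section \<open>Transfer to the matrices of the semidefinite program\<close>

theorem theorem3p1:
  fixes N k :: nat and W :: "real mat" and \<Gamma> :: "nat \<Rightarrow> nat set"
  assumes "W \<in> carrier_mat N N"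
    and "transpose_mat W = W"
    and "\<forall>i<N. \<forall>j<N. 0 \<le> W $$ (i, j)"
    and "partition_on {0..<N} (\<Gamma> ` {1..k})"
    and "inj_on \<Gamma> {1..k}"
    and "k < N"
  shows "(op_norm (D_delta k \<Gamma> W) < eigval (k + 1) (L_iso k \<Gamma> W) / 4 \<longrightarrow>
           {Z. is_arg_min (mat_inner (laplacian W)) (sdp_feasible N k) Z} = {X_rcut N k \<Gamma>})
       \<and> ereal (eigval (k + 1) (L_iso k \<Gamma> W)) =
           Min ((\<lambda>a. eigval2 (submatrix (L_iso k \<Gamma> W) (\<Gamma> a) (\<Gamma> a))) ` {1..k})"
proof -
  note W = assms(1) and k = assms(6)
  have w_sym: "W $$ (i, j) = W $$ (j, i)" if "i < N" "j < N" for i j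
    using transpose_mat_eqD[OF W assms(2) that] .
  have w_nonneg: "0 \<le> W $$ (i, j)" if "i < N" "j < N" for i j using assms(3) that by simp
  have union: "(\<Union>a\<in>{1..k}. \<Gamma> a) = {0..<N}"
    using partition_onD1[OF assms(4)] by simp
  \<comment> \<open>The partition makes different sets disjoint; injectivity of
    \<open>\<Gamma>\<close> turns equal sets into equal labels.\<close>
  have disj: "a = b" if "a \<in> {1..k}" "b \<in> {1..k}" "i \<in> \<Gamma> a" "i \<in> \<Gamma> b" for a b i
  proof (rule inj_onD[OF assms(5) _ that(1,2)])
    show "\<Gamma> a = \<Gamma> b"
      using disjointD[OF partition_onD2[OF assms(4)], of "\<Gamma> a" "\<Gamma> b"] that by blast
  qed
  have "\<exists>a. a \<in> {1..k} \<and> i \<in> \<Gamma> a" if "i < N" for i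
  proof -
    have "i \<in> (\<Union>a\<in>{1..k}. \<Gamma> a)" unfolding union using that by simp
    thus ?thesis by blast
  qed
  then obtain c where c: "\<And>i. i < N \<Longrightarrow> c i \<in> {1..k} \<and> i \<in> \<Gamma> (c i)" by metis
  have \<Gamma>_iff: "i \<in> \<Gamma> a \<longleftrightarrow> i < N \<and> c i = a" if "a \<in> {1..k}" for a i
  proof
    assume i: "i \<in> \<Gamma> a"
    hence "i \<in> (\<Union>a\<in>{1..k}. \<Gamma> a)" using that by blast
    hence "i < N" unfolding union by simp
    thus "i < N \<and> c i = a" using disj[of "c i" a i] c[of i] that i by blast
  qed (use c in blast)
  interpret clustering N k c
  proof
    show "c i \<in> {1..k}" if "i < N" for i using c that by blast
    show "\<exists>i<N. c i = a" if "a \<in> {1..k}" for a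
      using partition_onD3[OF assms(4)] that \<Gamma>_iff[OF that] by (metis equals0I imageI)
  qed
  have \<Gamma>_cluster: "\<Gamma> a = cluster a" if "a \<in> {1..k}" for a
    using \<Gamma>_iff[OF that] by (auto simp: cluster_def)
  define w where "w = entries W"
  have iso: "iso_mat k \<Gamma> W \<in> carrier_mat N N" using W by (simp add: iso_mat_def)
  have iso_index: "iso_mat k \<Gamma> W $$ (i, j) = inner_weight w i j" if "i < N" "j < N" for i j
  proof -
    have "(\<exists>a\<in>{1..k}. i \<in> \<Gamma> a \<and> j \<in> \<Gamma> a) \<longleftrightarrow> c i = c j"
      using that c \<Gamma>_iff by (metis (no_types))
    thus ?thesis using W that by (simp add: iso_mat_def inner_weight_def w_def)
  qed
  have L_iso: "L_iso k \<Gamma> W \<in> carrier_mat N N"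
    unfolding L_iso_def by (rule laplacian_carrier[OF iso])
  have L_iso_index: "L_iso k \<Gamma> W $$ (i, j) = lap N (inner_weight w) i j" if "i < N" "j < N" for i j
    unfolding L_iso_def laplacian_index[OF iso that] lap_def using that by (simp add: iso_index)
  note eig = eigval_inner_laplacian[where w = w, OF _ _ L_iso L_iso_index k]
  have Min: "ereal (eigval (k + 1) (L_iso k \<Gamma> W)) =
      Min ((\<lambda>a. eigval2 (submatrix (L_iso k \<Gamma> W) (\<Gamma> a) (\<Gamma> a))) ` {1..k})"
  proof -
    have "(\<lambda>a. eigval2 (submatrix (L_iso k \<Gamma> W) (\<Gamma> a) (\<Gamma> a))) ` {1..k}
        = (\<lambda>a. eigval2 (submatrix (L_iso k \<Gamma> W) (cluster a) (cluster a))) ` {1..k}"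
      by (rule image_cong[OF refl]) (simp only: \<Gamma>_cluster)
    thus ?thesis using eig(1) w_nonneg w_sym by (simp only: w_def)
  qed
  have X: "X_rcut N k \<Gamma> \<in> carrier_mat N N" by (simp add: X_rcut_def)
  have X_index: "X_rcut N k \<Gamma> $$ (i, j) = proj i j" if "i < N" "j < N" for i j
  proof -
    have "X_rcut N k \<Gamma> $$ (i, j) = (\<Sum>a=1..k. 1 / real (card (\<Gamma> a))
        * ((if i \<in> \<Gamma> a then 1 else 0) * (if j \<in> \<Gamma> a then 1 else 0)))"
      unfolding X_rcut_def using that by (simp add: outer_prod_def ind_vec_def)
    \<comment> \<open>Only the summand of the cluster containing \<open>i\<close> survives.\<close>
    also have "\<dots> = (\<Sum>a=1..k. if a = c i then (if c i = c j then 1 / real (card (\<Gamma> a)) else 0) else 0)"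
      by (rule sum.cong[OF refl]) (use that \<Gamma>_iff in auto)
    also have "\<dots> = (if c i = c j then 1 / real (card (\<Gamma> (c i))) else 0)"
      using c_range[OF that(1)] by simp
    also have "card (\<Gamma> (c i)) = card {j\<in>{..<N}. c j = c i}"
      using \<Gamma>_cluster[OF c_range[OF that(1)]] by (simp add: cluster_def)
    finally show ?thesis by (simp add: proj_def csize_def)
  qed
  have X_sym: "transpose_mat (X_rcut N k \<Gamma>) = X_rcut N k \<Gamma>"
    using X by (intro eq_matI) (auto simp: X_index proj_sym)
  have X_feasible: "sdp_feasible N k (X_rcut N k \<Gamma>)"
    unfolding sdp_feasible_def
  proof (intro conjI allI impI)
    show "psd (X_rcut N k \<Gamma>)"
      unfolding psd_def
    proof (intro conjI ballI)
      fix v :: "real vec" assume "v \<in> carrier_vec (dim_row (X_rcut N k \<Gamma>))"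
      hence v: "v \<in> carrier_vec N" using X by simp
      have "v \<bullet> (X_rcut N k \<Gamma> *\<^sub>v v) = (\<Sum>i<N. v $ i * (X_rcut N k \<Gamma> *\<^sub>v v) $ i)"
        using X by (simp add: scalar_prod_def atLeast0LessThan)
      also have "\<dots> = (\<Sum>i<N. v $ i * (\<Sum>j<N. proj i j * v $ j))"
        using mat_vec_index_sum[OF X v] by (intro sum.cong refl) (simp add: X_index)
      also have "\<dots> = qform N proj (\<lambda>i. v $ i)"
        by (simp add: qform_def sum_distrib_left mult_ac)
      finally show "0 \<le> v \<bullet> (X_rcut N k \<Gamma> *\<^sub>v v)" by (simp add: qform_proj sum_nonneg)
    qed (use X X_sym in auto)
    show "trace_mat (X_rcut N k \<Gamma>) = real k"
      using X by (simp add: trace_mat_def X_index proj_trace)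
    show "X_rcut N k \<Gamma> *\<^sub>v ones_vec N = ones_vec N"
    proof (rule eq_vecI)
      fix i assume "i < dim_vec (ones_vec N)"
      hence i: "i < N" by (simp add: ones_vec_def)
      have "(X_rcut N k \<Gamma> *\<^sub>v ones_vec N) $ i = (\<Sum>j<N. X_rcut N k \<Gamma> $$ (i, j) * ones_vec N $ j)"
        by (rule mat_vec_index_sum[OF X _ i]) (simp add: ones_vec_def)
      also have "\<dots> = 1" using i by (simp add: X_index ones_vec_def proj_row)
      finally show "(X_rcut N k \<Gamma> *\<^sub>v ones_vec N) $ i = ones_vec N $ i" using i by (simp add: ones_vec_def)
    qed (use X in \<open>simp add: ones_vec_def\<close>)
  qed (use X X_sym in \<open>auto simp: X_index proj_nonneg\<close>)
  have objective: "mat_inner (laplacian W) Z = (\<Sum>i<N. \<Sum>j<N. lap N w i j * Z $$ (i, j))"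
    if "Z \<in> carrier_mat N N" for Z
    unfolding mat_inner_sum[OF laplacian_carrier[OF W] that]
    by (intro sum.cong refl) (simp add: laplacian_index[OF W] w_def)
  have D: "D_delta k \<Gamma> W \<in> carrier_mat N N" 
    unfolding D_delta_def by (rule minus_carrier_mat[OF deg_mat_carrier[OF iso]])
  have D_index: "D_delta k \<Gamma> W $$ (i, j) = (if i = j then \<Sum>l<N. cut_weight w i l else 0)"
    if "i < N" "j < N" for i j
  proof -
    have "(\<Sum>l<N. w i l) - (\<Sum>l<N. inner_weight w i l) = (\<Sum>l<N. cut_weight w i l)" for i
      unfolding sum_subtractf[symmetric] by (intro sum.cong refl) (simp add: inner_weight_def cut_weight_def)
    thus ?thesis
      using that deg_mat_carrier[OF iso] by (simp add: D_delta_def deg_mat_index[OF W] deg_mat_index[OF iso] iso_index w_def)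
  qed
  have \<delta>: "(\<Sum>l<N. cut_weight w i l) \<le> op_norm (D_delta k \<Gamma> W)" if "i < N" for i
  proof -
    have "diagonal_mat (D_delta k \<Gamma> W)" using D by (auto simp: diagonal_mat_def D_index)
    from abs_diag_le_op_norm[OF D this that] show ?thesis using D_index[OF that that] by simp
  qed
  have "{Z. is_arg_min (mat_inner (laplacian W)) (sdp_feasible N k) Z} = {X_rcut N k \<Gamma>}"
    if gap: "op_norm (D_delta k \<Gamma> W) < eigval (k + 1) (L_iso k \<Gamma> W) / 4"
  proof -
    \<comment> \<open>One inequality gives both parts: a positive factor times the nonnegative
      defect yields minimality, and equal values force the defect to be zero.\<close>
    have main: "mat_inner (laplacian W) (X_rcut N k \<Gamma>) \<le> mat_inner (laplacian W) Z
        \<and> (mat_inner (laplacian W) Z \<le> mat_inner (laplacian W) (X_rcut N k \<Gamma>) \<longrightarrow> Z = X_rcut N k \<Gamma>)"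
      if "sdp_feasible N k Z" for Z
    proof -
      interpret clustering_sdp N k c Z by unfold_locales (rule that)
      have "(eigval (k + 1) (L_iso k \<Gamma> W) - 4 * op_norm (D_delta k \<Gamma> W)) * defect
          \<le> (\<Sum>i<N. \<Sum>j<N. lap N w i j * z i j) - (\<Sum>i<N. \<Sum>j<N. lap N w i j * proj i j)"
        by (rule objective_gap[OF _ _ \<delta> eig(3)]) (auto simp: w_def intro: w_nonneg w_sym)
      also have "\<dots> = mat_inner (laplacian W) Z - mat_inner (laplacian W) (X_rcut N k \<Gamma>)"
        by (simp add: objective[OF Z_carrier] objective[OF X] X_index)
      finally have *: "(eigval (k + 1) (L_iso k \<Gamma> W) - 4 * op_norm (D_delta k \<Gamma> W)) * defect
          \<le> mat_inner (laplacian W) Z - mat_inner (laplacian W) (X_rcut N k \<Gamma>)" .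
      have pos: "0 < eigval (k + 1) (L_iso k \<Gamma> W) - 4 * op_norm (D_delta k \<Gamma> W)" using gap by simp
      show ?thesis
      proof (intro conjI impI)
        show "mat_inner (laplacian W) (X_rcut N k \<Gamma>) \<le> mat_inner (laplacian W) Z"
          using * mult_nonneg_nonneg[OF less_imp_le[OF pos] defect_nonneg] by linarith
        assume "mat_inner (laplacian W) Z \<le> mat_inner (laplacian W) (X_rcut N k \<Gamma>)"
        hence "(eigval (k + 1) (L_iso k \<Gamma> W) - 4 * op_norm (D_delta k \<Gamma> W)) * defect \<le> 0"
          using * by linarith
        hence "defect = 0" using pos defect_nonneg by (simp add: mult_le_0_iff)
        thus "Z = X_rcut N k \<Gamma>"
          using X Z_carrier by (intro eq_matI) (auto simp: X_index defect_zero_imp_proj)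
      qed
    qed
    show ?thesis
    proof (intro equalityI subsetI)
      fix Z assume "Z \<in> {Z. is_arg_min (mat_inner (laplacian W)) (sdp_feasible N k) Z}"
      \<comment> \<open>\<open>is_arg_min\<close> only excludes strictly smaller values; since
        \<open>X_rcut\<close> is feasible, the value at \<open>Z\<close> is at most that at
        \<open>X_rcut\<close>.\<close>
      hence Z: "sdp_feasible N k Z" "\<not> mat_inner (laplacian W) (X_rcut N k \<Gamma>) < mat_inner (laplacian W) Z"
        using X_feasible by (auto simp: is_arg_min_def)
      thus "Z \<in> {X_rcut N k \<Gamma>}" using main[OF Z(1)] unfolding not_less singleton_iff by blast
    next
      fix Z assume "Z \<in> {X_rcut N k \<Gamma>}"
      hence "Z = X_rcut N k \<Gamma>" by blast
      thus "Z \<in> {Z. is_arg_min (mat_inner (laplacian W)) (sdp_feasible N k) Z}"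
        unfolding mem_Collect_eq is_arg_min_def using X_feasible main by (metis leD)
    qed
  qed
  thus ?thesis using Min by blast
qed

end
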